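(* Let $\psi\colon(0,\infty)\to(0,\infty)$ be a nonincreasing function with $\lim_{x\to+\infty}\psi(x)=0$, and let $\lambda(\psi)=\liminf_{x\to\infty}\frac{-\log\psi(x)}{\log x}$. Let \[W(\psi)=\bigl\{z\in\mathbb D^*: |z-p/q|\le\psi(|q|)\text{ for infinitely many }p,q\in\mathbb Z[i]\bigr\}.\] Then $\dim_{\mathrm H}W(\psi)=\min\bigl(4/\lambda(\psi),2\bigr)$ and $\dim_{\mathrm P}W(\psi)=2$, where $\dim_{\mathrm H}$ and $\dim_{\mathrm P}$ denote Hausdorff and packing dimension.
   Context: $\mathbb D=\{x+iy: x,y\in[-1/2,1/2)\}$ and $\mathbb D^*=\mathbb D\setminus\{0\}$. If $\lambda(\psi)=\infty$, $4/\lambda(\psi)$ is interpreted as $0$. *)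

theory Defs
  imports "HOL-Analysis.Analysis"
begin

text \<open>
  The summand \<open>|U|\<^sup>s\<close>, with the usual conventions \<open>|{}|\<^sup>s = 0\<close> and \<open>|U|\<^sup>0 = 1\<close> for nonempty \<open>U\<close>.
  The case distinction is needed because \<^term>\<open>(0::real) powr 0 = 0\<close>.
\<close>

definition diam_pow :: "real \<Rightarrow> 'a::metric_space set \<Rightarrow> ennreal" where
  "diam_pow s U =
     (if U = {} then 0 else if s = 0 then 1 else ennreal (diameter U powr s))"

text \<open>
  Boundedness of the covering sets is explicit because \<^const>\<open>diameter\<close> is
  only meaningful on bounded sets.
\<close>

definition hausdorff_premeasure :: "real \<Rightarrow> real \<Rightarrow> 'a::metric_space set \<Rightarrow> ennreal" where
  "hausdorff_premeasure s \<delta> E =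
     (INF U \<in> {U :: nat \<Rightarrow> 'a set. E \<subseteq> (\<Union>i. U i) \<and> (\<forall>i. bounded (U i) \<and> diameter (U i) \<le> \<delta>)}.
        \<Sum>i. diam_pow s (U i))"

definition hausdorff_measure :: "real \<Rightarrow> 'a::metric_space set \<Rightarrow> ennreal" where
  "hausdorff_measure s E = (SUP \<delta> \<in> {0<..}. hausdorff_premeasure s \<delta> E)"

definition hausdorff_dim :: "'a::metric_space set \<Rightarrow> ereal" where
  "hausdorff_dim E = Inf {ereal s | s. 0 \<le> s \<and> hausdorff_measure s E = 0}"

text \<open>
  A \<open>\<delta>\<close>-packing of \<open>E\<close>, given by the centres and radii of its balls.
\<close>

definition is_packing :: "real \<Rightarrow> 'a::metric_space set \<Rightarrow> ('a \<times> real) set \<Rightarrow> bool" where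
  "is_packing \<delta> E C \<longleftrightarrow>
     countable C \<and> (\<forall>(x, r) \<in> C. x \<in> E \<and> 0 < r \<and> r \<le> \<delta>) \<and>
     disjoint_family_on (\<lambda>(x, r). cball x r) C"

definition packing_premeasure :: "real \<Rightarrow> 'a::metric_space set \<Rightarrow> ennreal" where
  "packing_premeasure s E =
     (INF \<delta> \<in> {0<..}. SUP C \<in> {C. is_packing \<delta> E C}.
        \<Sum>\<^sub>\<infinity>(x, r) \<in> C. ennreal ((2 * r) powr s))"

text \<open>
  The packing premeasure is not countably subadditive, hence the second infimum
  over countable covers.
\<close>

definition packing_measure :: "real \<Rightarrow> 'a::metric_space set \<Rightarrow> ennreal" where
  "packing_measure s E =
     (INF F \<in> {F :: nat \<Rightarrow> 'a set. E \<subseteq> (\<Union>i. F i)}. \<Sum>i. packing_premeasure s (F i))"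

definition packing_dim :: "'a::metric_space set \<Rightarrow> ereal" where
  "packing_dim E = Inf {ereal s | s. 0 \<le> s \<and> packing_measure s E = 0}"

definition gauss_ints :: "complex set" where
  "gauss_ints = {z. Re z \<in> \<int> \<and> Im z \<in> \<int>}"

definition unit_square :: "complex set" where
  "unit_square = {z. Re z \<in> {-1/2..<1/2} \<and> Im z \<in> {-1/2..<1/2}}"

definition lower_order :: "(real \<Rightarrow> real) \<Rightarrow> ereal" where
  "lower_order \<psi> = Liminf at_top (\<lambda>x::real. ereal (- ln (\<psi> x) / ln x))"

definition approximable_set :: "(real \<Rightarrow> real) \<Rightarrow> complex set" where
  "approximable_set \<psi> =
     {z \<in> unit_square - {0}.
        infinite {(p, q). p \<in> gauss_ints \<and> q \<in> gauss_ints \<and> q \<noteq> 0 \<and>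
                          cmod (z - p / q) \<le> \<psi> (cmod q)}}"

end

theory Submission
  imports Defs
begin

text \<open>
  The upper bound \<open>4 / \<lambda>\<close> comes from covering by the balls around \<open>p / q\<close> with
  \<open>2\<^sup>j \<le> |q| < 2\<^sup>j\<^sup>+\<^sup>1\<close>: there are \<open>O(16\<^sup>j)\<close> of them, of radius \<open>2\<^sup>-\<^sup>b\<^sup>j\<close> for any \<open>b < \<lambda>\<close>.

  For the lower bound, Dirichlet's theorem and an area count show that every disc of radius \<open>r\<close>
  contains, for large \<open>n\<close>, about \<open>r\<^sup>2 n\<^sup>4\<close> fractions with denominator at most \<open>2n\<close>, and these are
  \<open>1 / (4 n\<^sup>2)\<close>-separated. If \<open>b > max \<lambda> 2\<close> and \<open>b s < 4\<close>, there are arbitrarily large \<open>n\<close> for which the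
  discs of radius \<open>(2n)\<^sup>-\<^sup>b\<close> around these fractions are admissible. Given balls with small
  \<open>\<Sum> \<rho>\<^sub>i\<^sup>s\<close>, averaging over the fractions yields a nested sequence of such discs that
  avoids ever more of the given balls; its limit is an approximable point that they do not cover.

  The approximable points contain a dense \<open>G\<^sub>\<delta>\<close> of the square. By Baire, one of the sets in any
  countable cover is dense in some disc, and such a set has infinite \<open>s\<close>-dimensional packing premeasure
  for all \<open>s < 2\<close>.
\<close>

subsection \<open>Discs in the plane and Gaussian fractions\<close>

lemma content_cball_complex: "0 \<le> r \<Longrightarrow> measure lborel (cball (c::complex) r) = pi * r\<^sup>2"
  by (simp add: content_cball unit_ball_vol_2)

lemma content_ball_complex: "0 \<le> r \<Longrightarrow> measure lborel (ball (c::complex) r) = pi * r\<^sup>2"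
  by (simp add: content_ball unit_ball_vol_2)

text \<open>Compare areas and cancel the factor pi.\<close>

lemma sum_radii_squared_le_of_disjoint:
  fixes c :: "'i \<Rightarrow> complex"
  assumes "finite I" "disjoint_family_on (\<lambda>i. ball (c i) (r i)) I"
    and r: "\<And>i. i \<in> I \<Longrightarrow> 0 \<le> r i" and "0 \<le> R"
    and sub: "\<And>i. i \<in> I \<Longrightarrow> ball (c i) (r i) \<subseteq> cball w R"
  shows "(\<Sum>i\<in>I. (r i)\<^sup>2) \<le> R\<^sup>2"
proof -
  have "pi * (\<Sum>i\<in>I. (r i)\<^sup>2) = (\<Sum>i\<in>I. measure lebesgue (ball (c i) (r i)))"
    by (simp add: sum_distrib_left content_ball_complex r)
  also have "\<dots> = measure lebesgue (\<Union>i\<in>I. ball (c i) (r i))"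
    using assms by (intro measure_UNION'[symmetric])
      (auto simp: pairwise_def disjoint_family_on_def disjnt_def)
  also have "\<dots> \<le> measure lebesgue (cball w R)"
    using sub by (intro measure_mono_fmeasurable) (auto intro!: sets.finite_UN \<open>finite I\<close>)
  also have "\<dots> = pi * R\<^sup>2"
    using \<open>0 \<le> R\<close> by (simp add: content_cball_complex)
  finally show ?thesis by simp
qed

text \<open>Again by area. Two families with separate index types let small and large denominators
  be estimated differently.\<close>

lemma radius_squared_le_of_cover:
  fixes c :: "'i \<Rightarrow> complex" and c' :: "'j \<Rightarrow> complex"
  assumes "finite I" "finite J" "0 \<le> R"
    and r: "\<And>i. i \<in> I \<Longrightarrow> 0 \<le> r i" and r': "\<And>j. j \<in> J \<Longrightarrow> 0 \<le> r' j"
    and sub: "cball w R \<subseteq> (\<Union>i\<in>I. cball (c i) (r i)) \<union> (\<Union>j\<in>J. cball (c' j) (r' j))"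
  shows "R\<^sup>2 \<le> (\<Sum>i\<in>I. (r i)\<^sup>2) + (\<Sum>j\<in>J. (r' j)\<^sup>2)"
proof -
  let ?A = "\<Union>i\<in>I. cball (c i) (r i)" and ?B = "\<Union>j\<in>J. cball (c' j) (r' j)"
  have meas: "?A \<in> lmeasurable" "?B \<in> lmeasurable"
    using assms by (auto intro!: fmeasurable.finite_UN)
  have "pi * R\<^sup>2 = measure lebesgue (cball w R)"
    using \<open>0 \<le> R\<close> by (simp add: content_cball_complex)
  also have "\<dots> \<le> measure lebesgue (?A \<union> ?B)"
    using sub meas by (intro measure_mono_fmeasurable) auto
  also have "\<dots> \<le> measure lebesgue ?A + measure lebesgue ?B"
    using meas by (intro measure_Un_le) (auto simp: fmeasurableD)
  also have "\<dots> \<le> (\<Sum>i\<in>I. measure lebesgue (cball (c i) (r i))) + (\<Sum>j\<in>J. measure lebesgue (cball (c' j) (r' j)))"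
    using assms by (intro add_mono measure_UNION_le) auto
  also have "\<dots> = pi * ((\<Sum>i\<in>I. (r i)\<^sup>2) + (\<Sum>j\<in>J. (r' j)\<^sup>2))"
    by (simp add: sum_distrib_left distrib_left content_cball_complex r r')
  finally show ?thesis by simp
qed

text \<open>The open discs of radius \<open>d / 2\<close> around the points are disjoint and lie in
  \<open>cball w (R + d / 2)\<close>; the quotient of the areas is the bound. Proved first for
  finite subsets, it forces \<open>A\<close> itself to be finite.\<close>

lemma card_separated_le:
  fixes A :: "complex set"
  assumes sub: "A \<subseteq> cball w R" and "0 < d"
    and sep: "\<And>a b. a \<in> A \<Longrightarrow> b \<in> A \<Longrightarrow> a \<noteq> b \<Longrightarrow> d \<le> dist a b"
  shows "finite A" "real (card A) \<le> (2 * R / d + 1)\<^sup>2"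
proof -
  have *: "real (card B) \<le> (2 * R / d + 1)\<^sup>2" if B: "B \<subseteq> A" "finite B" for B
  proof (cases "B = {}")
    case False
    then obtain b where "b \<in> B" by auto
    then have "dist w b \<le> R" using sub B by auto
    then have "0 \<le> R" using zero_le_dist[of w b] by linarith
    have "(\<Sum>b\<in>B. (d / 2)\<^sup>2) \<le> (R + d / 2)\<^sup>2"
    proof (rule sum_radii_squared_le_of_disjoint[where c = "\<lambda>b. b" and w = w])
      show "disjoint_family_on (\<lambda>b. ball b (d / 2)) B"
        unfolding disjoint_family_on_def
      proof (intro ballI impI, rule ccontr)
        fix a b assume ab: "a \<in> B" "b \<in> B" "a \<noteq> b" "ball a (d / 2) \<inter> ball b (d / 2) \<noteq> {}"
        then obtain x where "dist a x < d / 2" "dist b x < d / 2" by auto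
        then have "dist a b < d" by (metis dist_triangle_half_l dist_commute)
        with sep[of a b] ab B show False by auto
      qed
      show "ball b (d / 2) \<subseteq> cball w (R + d / 2)" if "b \<in> B" for b
      proof
        fix x assume "x \<in> ball b (d / 2)"
        moreover have "dist w b \<le> R" using sub B that by auto
        ultimately show "x \<in> cball w (R + d / 2)"
          using dist_triangle[of w x b] by simp
      qed
    qed (use B \<open>0 \<le> R\<close> \<open>0 < d\<close> in auto)
    moreover have "R + d / 2 = (2 * R / d + 1) * (d / 2)"
      using \<open>0 < d\<close> by (simp add: field_simps)
    ultimately have "real (card B) * (d / 2)\<^sup>2 \<le> (2 * R / d + 1)\<^sup>2 * (d / 2)\<^sup>2"
      by (simp only: sum_constant power_mult_distrib)
    then show ?thesis using \<open>0 < d\<close> by simp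
  qed simp
  show fin: "finite A"
  proof -
    have "card B \<le> nat \<lceil>(2 * R / d + 1)\<^sup>2\<rceil>" if "B \<subseteq> A" "finite B" for B
      using *[OF that] by linarith
    then show ?thesis using finite_if_finite_subsets_card_bdd by blast
  qed
  show "real (card A) \<le> (2 * R / d + 1)\<^sup>2"
    using * fin by blast
qed

section \<open>Gaussian integers and their fractions: lattice counts, separation,
  approximation\<close>

lemma gauss_ints_diff: "a \<in> gauss_ints \<Longrightarrow> b \<in> gauss_ints \<Longrightarrow> a - b \<in> gauss_ints"
  and gauss_ints_mult: "a \<in> gauss_ints \<Longrightarrow> b \<in> gauss_ints \<Longrightarrow> a * b \<in> gauss_ints"
  and gauss_ints_of_nat [simp]: "of_nat n \<in> gauss_ints"
  and gauss_ints_Complex_of_int [simp]: "Complex (of_int i) (of_int j) \<in> gauss_ints"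
  by (auto simp: gauss_ints_def)

lemma gauss_ints_norm_ge_1:
  assumes "q \<in> gauss_ints" "q \<noteq> 0"
  shows "1 \<le> cmod q"
proof -
  have "\<bar>Re q\<bar> \<ge> 1 \<or> \<bar>Im q\<bar> \<ge> 1"
    using assms by (auto simp: gauss_ints_def complex_eq_iff Ints_nonzero_abs_ge1)
  then show ?thesis
    using abs_Re_le_cmod[of q] abs_Im_le_cmod[of q] by linarith
qed

lemma gauss_ints_in_cball:
  shows "finite (gauss_ints \<inter> cball w R)" "real (card (gauss_ints \<inter> cball w R)) \<le> (2 * R + 1)\<^sup>2"
proof -
  have "1 \<le> dist a b" if "a \<in> gauss_ints" "b \<in> gauss_ints" "a \<noteq> b" for a b
    using gauss_ints_norm_ge_1[OF gauss_ints_diff[OF that(1,2)]] that(3) by (simp add: dist_norm)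
  then show "finite (gauss_ints \<inter> cball w R)" "real (card (gauss_ints \<inter> cball w R)) \<le> (2 * R + 1)\<^sup>2"
    using card_separated_le[of "gauss_ints \<inter> cball w R" w R 1] by auto
qed

text \<open>The difference of the fractions is \<open>(p * q' - p' * q) / (q * q')\<close> up to
  sign conventions of \<open>dist\<close>, and its numerator is a nonzero Gaussian integer.\<close>

lemma fractions_separated:
  assumes "p \<in> gauss_ints" "q \<in> gauss_ints" "p' \<in> gauss_ints" "q' \<in> gauss_ints"
    and "q \<noteq> 0" "q' \<noteq> 0" "cmod q \<le> Q" "cmod q' \<le> Q" "p / q \<noteq> p' / q'"
  shows "1 / Q\<^sup>2 \<le> dist (p / q) (p' / q')"
proof -
  have "p * q' - p' * q \<noteq> 0" using assms by (auto simp: field_simps)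
  then have "1 \<le> cmod (p * q' - p' * q)"
    using assms by (intro gauss_ints_norm_ge_1 gauss_ints_diff gauss_ints_mult)
  moreover have "0 < cmod q * cmod q'" "cmod q * cmod q' \<le> Q\<^sup>2"
    using assms by (auto simp: power2_eq_square intro!: mult_mono order_trans[OF norm_ge_zero])
  ultimately have "1 / Q\<^sup>2 \<le> cmod (p * q' - p' * q) / (cmod q * cmod q')"
    by (intro frac_le) auto
  also have "\<dots> = dist (p / q) (p' / q')"
    using assms by (simp add: dist_norm diff_frac_eq norm_divide norm_mult)
  finally show ?thesis .
qed

text \<open>Pigeonhole: \<open>(n + 1)^2\<close> multipliers with coordinates in
  \<open>{..n}\<close> send the fractional parts of their products with \<open>z\<close> into
  \<open>n^2\<close> boxes of side \<open>1 / n\<close>. Two multipliers sharing a box have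
  difference \<open>q\<close>. The factors 2 come from bounding a modulus by the sum of its
  coordinates.\<close>

lemma dirichlet_gauss:
  fixes z :: complex
  assumes "0 < n"
  obtains p q where "p \<in> gauss_ints" "q \<in> gauss_ints" "q \<noteq> 0" "cmod q \<le> 2 * real n"
    "cmod (q * z - p) \<le> 2 / real n"
proof -
  define C where "C = (\<lambda>(a::nat, b::nat). Complex (real a) (real b))"
  define f where "f = (\<lambda>x. (nat \<lfloor>n * frac (Re (C x * z))\<rfloor>, nat \<lfloor>n * frac (Im (C x * z))\<rfloor>))"
  have bnd: "nat \<lfloor>real n * frac t\<rfloor> < n" for t
  proof -
    have "real n * frac t < real n * 1"
      using assms frac_lt_1[of t] by (intro mult_strict_left_mono) auto
    moreover have "0 \<le> real n * frac t" by simp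
    ultimately show ?thesis by (simp add: nat_less_iff floor_less_iff)
  qed
  have "f ` ({..n} \<times> {..n}) \<subseteq> {..<n} \<times> {..<n}"
    by (auto simp: f_def bnd)
  then have "card (f ` ({..n} \<times> {..n})) \<le> card ({..<n} \<times> {..<n})"
    by (intro card_mono) auto
  also have "\<dots> < card ({..n} \<times> {..n})"
    by (simp add: card_cartesian_product)
  finally have "\<not> inj_on f ({..n} \<times> {..n})" by (rule pigeonhole)
  then obtain a b a' b' where ab: "a \<le> n" "b \<le> n" "a' \<le> n" "b' \<le> n" "(a, b) \<noteq> (a', b')"
    "f (a, b) = f (a', b')"
    by (auto simp: inj_on_def)
  define q where "q = C (a, b) - C (a', b')"
  \<comment> \<open>Coordinatewise floors, so that the coordinates of \<open>q * z - p\<close> are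
    differences of fractional parts.\<close>
  define F where "F = (\<lambda>w. Complex (of_int \<lfloor>Re w\<rfloor>) (of_int \<lfloor>Im w\<rfloor>))"
  define p where "p = F (C (a, b) * z) - F (C (a', b') * z)"
  have C: "C x \<in> gauss_ints" for x
    by (cases x) (simp add: C_def gauss_ints_def)
  have close: "\<bar>frac s - frac t\<bar> \<le> 1 / n" if "nat \<lfloor>real n * frac s\<rfloor> = nat \<lfloor>real n * frac t\<rfloor>" for s t
  proof -
    have "\<lfloor>real n * frac s\<rfloor> = \<lfloor>real n * frac t\<rfloor>"
      using that by (simp add: eq_nat_nat_iff)
    then have "\<bar>real n * frac s - real n * frac t\<bar> \<le> 1" by linarith
    then have "real n * \<bar>frac s - frac t\<bar> \<le> 1"
      by (simp add: abs_mult right_diff_distrib[symmetric])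
    then show ?thesis using assms by (simp add: field_simps)
  qed
  have "cmod q \<le> \<bar>Re q\<bar> + \<bar>Im q\<bar>" by (rule cmod_le)
  also have "\<dots> \<le> 2 * real n" using ab by (auto simp: q_def C_def)
  finally have 1: "cmod q \<le> 2 * real n" .
  have "cmod (q * z - p) \<le> \<bar>Re (q * z - p)\<bar> + \<bar>Im (q * z - p)\<bar>" by (rule cmod_le)
  also have "Re (q * z - p) = frac (Re (C (a, b) * z)) - frac (Re (C (a', b') * z))"
    by (simp add: q_def p_def F_def frac_def algebra_simps)
  also have "Im (q * z - p) = frac (Im (C (a, b) * z)) - frac (Im (C (a', b') * z))"
    by (simp add: q_def p_def F_def frac_def algebra_simps)
  also have "\<bar>frac (Re (C (a, b) * z)) - frac (Re (C (a', b') * z))\<bar>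
      + \<bar>frac (Im (C (a, b) * z)) - frac (Im (C (a', b') * z))\<bar> \<le> 1 / n + 1 / n"
    using ab(6) unfolding f_def by (intro add_mono close) simp_all
  finally have 2: "cmod (q * z - p) \<le> 2 / real n" by simp
  show thesis
  proof (rule that[of p q])
    show "q \<noteq> 0" using ab by (auto simp: q_def C_def complex_eq_iff)
    show "q \<in> gauss_ints" unfolding q_def by (intro gauss_ints_diff C)
    show "p \<in> gauss_ints" unfolding p_def F_def by (intro gauss_ints_diff gauss_ints_Complex_of_int)
  qed (use 1 2 in auto)
qed

text \<open>A term with \<open>cmod q > 1 / \<rho>\<close> is at most \<open>\<rho>^2\<close>; the
  others are at most 1 each, and a lattice count bounds their number. With \<open>\<rho>\<close>
  fixed this crude splitting replaces a logarithmic estimate.\<close>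

lemma sum_inverse_norm_squared_le:
  fixes \<rho> :: real
  assumes "finite Q" "Q \<subseteq> gauss_ints" "0 \<notin> Q" "0 < \<rho>"
  shows "(\<Sum>q\<in>Q. 1 / (cmod q)\<^sup>2) \<le> \<rho>\<^sup>2 * card Q + (2 / \<rho> + 1)\<^sup>2"
proof -
  let ?S = "gauss_ints \<inter> cball 0 (1 / \<rho>)"
  have "(\<Sum>q\<in>Q. 1 / (cmod q)\<^sup>2) \<le> (\<Sum>q\<in>Q. \<rho>\<^sup>2 + (if q \<in> ?S then 1 else 0))"
  proof (rule sum_mono)
    fix q assume q: "q \<in> Q"
    then have 1: "1 \<le> cmod q" using assms by (intro gauss_ints_norm_ge_1) auto
    show "1 / (cmod q)\<^sup>2 \<le> \<rho>\<^sup>2 + (if q \<in> ?S then 1 else 0)"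
    proof (cases "q \<in> ?S")
      case True
      have "1 / (cmod q)\<^sup>2 \<le> 1" using one_le_power[OF 1, of 2] by (simp add: divide_le_eq)
      then show ?thesis using True by (simp add: add_increasing)
    next
      case False
      then have "1 / \<rho> < cmod q" using q assms(2) by auto
      moreover have "q \<noteq> 0" using q assms(3) by auto
      ultimately have "1 / cmod q \<le> \<rho>" using assms(4) by (simp add: field_simps)
      then have "(1 / cmod q)\<^sup>2 \<le> \<rho>\<^sup>2" using 1 by (intro power_mono) auto
      then show ?thesis using False by (simp add: power_divide)
    qed
  qed
  also have "\<dots> = \<rho>\<^sup>2 * card Q + card (Q \<inter> ?S)"
    by (simp add: sum.distrib sum.If_cases assms(1) Int_def)
  also have "real (card (Q \<inter> ?S)) \<le> card ?S"
    by (intro of_nat_mono card_mono gauss_ints_in_cball) auto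
  also have "real (card ?S) \<le> (2 / \<rho> + 1)\<^sup>2"
    using gauss_ints_in_cball(2)[of 0 "1 / \<rho>"] by simp
  finally show ?thesis by simp
qed

text \<open>
  By Dirichlet's theorem the balls around the fractions with denominator at most \<open>2n\<close> cover the disc.
  The denominators below \<open>n/100\<close> account for at most half of its area, and all other balls
  have radius \<open>O(n\<^sup>-\<^sup>2)\<close>, so there must be many of them.
\<close>

lemma many_separated_fractions:
  fixes w :: complex
  assumes \<rho>: "0 < \<rho>" "\<rho> \<le> 1" and n: "100 / \<rho>\<^sup>2 \<le> real n"
  obtains G where "finite G" "G \<subseteq> cball w (2 * \<rho>)" "\<rho>\<^sup>2 * real n ^ 4 / 80000 \<le> real (card G)"
    "\<And>g. g \<in> G \<Longrightarrow> \<exists>p\<in>gauss_ints. \<exists>q\<in>gauss_ints. q \<noteq> 0 \<and> cmod q \<le> 2 * real n \<and> g = p / q"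
    "\<And>g h. g \<in> G \<Longrightarrow> h \<in> G \<Longrightarrow> g \<noteq> h \<Longrightarrow> 1 / (4 * (real n)\<^sup>2) \<le> dist g h"
proof -
  have "\<rho>\<^sup>2 \<le> 1" using \<rho> by (simp add: power_le_one)
  have "100 \<le> 100 / \<rho>\<^sup>2" using \<rho> \<open>\<rho>\<^sup>2 \<le> 1\<close> by (simp add: field_simps)
  with n have n100: "100 \<le> real n" by linarith
  have n\<rho>: "100 \<le> real n * \<rho>\<^sup>2" using n \<rho> by (simp add: field_simps)
  define G where "G = {p / q | p q. p \<in> gauss_ints \<and> q \<in> gauss_ints \<and> q \<noteq> 0 \<and> cmod q \<le> 2 * real n}
                        \<inter> cball w (2 * \<rho>)"
  \<comment> \<open>\<open>Qs\<close> holds the small denominators, and \<open>P q\<close> every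
    numerator \<open>p\<close> that Dirichlet's theorem can produce with \<open>q\<close> for a
    point of \<open>cball w \<rho>\<close>.\<close>
  define Qs where "Qs = gauss_ints \<inter> cball 0 (real n / 100) - {0}"
  define P where "P = (\<lambda>q. gauss_ints \<inter> cball (q * w) (cmod q * \<rho> + 1))"
  have sep: "1 / (4 * (real n)\<^sup>2) \<le> dist g h" if "g \<in> G" "h \<in> G" "g \<noteq> h" for g h
    using that fractions_separated[where Q = "2 * real n"] by (auto simp: G_def power_mult_distrib)
  have finG: "finite G"
    by (rule card_separated_le[where w = w and R = "2 * \<rho>" and d = "1 / (4 * (real n)\<^sup>2)"])
      (use sep n100 in \<open>auto simp: G_def\<close>)
  have finQ: "finite Qs" unfolding Qs_def using gauss_ints_in_cball by blast
  have finP: "finite (P q)" for q unfolding P_def using gauss_ints_in_cball by blast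
  have Qs0: "q \<noteq> 0" if "q \<in> Qs" for q
    using that by (auto simp: Qs_def)

  have cover: "cball w \<rho> \<subseteq> (\<Union>x\<in>Sigma Qs P. cball (snd x / fst x) (2 / (real n * cmod (fst x))))
                  \<union> (\<Union>g\<in>G. cball g (200 / (real n)\<^sup>2))"
  proof
    fix z assume z: "z \<in> cball w \<rho>"
    obtain p q where pq: "p \<in> gauss_ints" "q \<in> gauss_ints" "q \<noteq> 0" "cmod q \<le> 2 * real n"
      and le: "cmod (q * z - p) \<le> 2 / real n"
      using dirichlet_gauss[of n z] n100 by auto
    have q1: "1 \<le> cmod q" using pq by (intro gauss_ints_norm_ge_1)
    have "z - p / q = (q * z - p) / q" using pq by (simp add: field_simps)
    then have "cmod (z - p / q) = cmod (q * z - p) / cmod q" by (simp add: norm_divide)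
    also have "\<dots> \<le> (2 / real n) / cmod q" using le by (intro divide_right_mono) auto
    finally have d: "dist (p / q) z \<le> 2 / (real n * cmod q)"
      by (simp add: dist_norm norm_minus_commute)
    show "z \<in> (\<Union>x\<in>Sigma Qs P. cball (snd x / fst x) (2 / (real n * cmod (fst x))))
                  \<union> (\<Union>g\<in>G. cball g (200 / (real n)\<^sup>2))"
    proof (cases "cmod q \<le> real n / 100")
      case True
      have "q * w - p = q * (w - z) + (q * z - p)" by (simp add: algebra_simps)
      then have "cmod (q * w - p) \<le> cmod (q * (w - z)) + cmod (q * z - p)"
        by (metis norm_triangle_ineq)
      also have "\<dots> \<le> cmod q * \<rho> + 2 / real n"
        using z le by (intro add_mono) (auto simp: norm_mult dist_norm intro!: mult_left_mono)
      also have "2 / real n \<le> 1" using n100 by simp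
      finally have "p \<in> P q" using pq by (simp add: P_def dist_norm)
      moreover have "q \<in> Qs" using True pq by (simp add: Qs_def)
      ultimately have "(q, p) \<in> Sigma Qs P" by simp
      then show ?thesis using d by force
    next
      case False
      have "2 / (real n * cmod q) \<le> 2 / (real n * (real n / 100))"
        using False n100 q1 by (intro divide_left_mono mult_left_mono mult_pos_pos) auto
      also have "\<dots> = 200 / (real n)\<^sup>2" by (simp add: power2_eq_square)
      finally have d2: "dist (p / q) z \<le> 200 / (real n)\<^sup>2" using d by simp
      \<comment> \<open>This keeps \<open>p / q\<close> within \<open>2 * \<rho>\<close> of
        \<open>w\<close>, hence in \<open>G\<close>.\<close>
      have "200 / (real n)\<^sup>2 \<le> \<rho>"
      proof -
        have "200 \<le> 100 * (real n * \<rho>\<^sup>2)" using n\<rho> by simp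
        also have "\<dots> \<le> real n * (real n * \<rho>\<^sup>2)" using n100 by (intro mult_right_mono) auto
        also have "\<dots> \<le> real n * (real n * \<rho>)"
          using \<rho> by (intro mult_left_mono) (auto simp: power2_eq_square mult_left_le)
        finally show ?thesis using n100 by (simp add: field_simps power2_eq_square)
      qed
      then have "dist w (p / q) \<le> 2 * \<rho>"
        using d2 z dist_triangle2[of w "p / q" z] by (simp add: dist_commute)
      then have "p / q \<in> G" using pq by (auto simp: G_def)
      then show ?thesis using d2 by auto
    qed
  qed

  have cardQ: "real (card Qs) \<le> (real n)\<^sup>2 * (9 / 10000)"
  proof -
    have "real (card Qs) \<le> card (gauss_ints \<inter> cball 0 (real n / 100))"
      unfolding Qs_def using gauss_ints_in_cball(1)[of 0 "real n / 100"] by (intro of_nat_mono card_mono) auto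
    also have "\<dots> \<le> (2 * (real n / 100) + 1)\<^sup>2" by (rule gauss_ints_in_cball)
    also have "\<dots> \<le> (3 * (real n / 100))\<^sup>2" using n100 by (intro power_mono) auto
    finally show ?thesis by (simp add: power2_eq_square)
  qed
  have bad: "(\<Sum>x\<in>Sigma Qs P. (2 / (real n * cmod (fst x)))\<^sup>2) \<le> \<rho>\<^sup>2 / 2"
  proof -
    have "(\<Sum>x\<in>Sigma Qs P. (2 / (real n * cmod (fst x)))\<^sup>2)
        = (\<Sum>q\<in>Qs. real (card (P q)) * (2 / (real n * cmod q))\<^sup>2)"
      using finQ finP by (subst sum.Sigma[symmetric, where g = "\<lambda>q p. (2 / (real n * cmod q))\<^sup>2", unfolded split_beta]) auto
    also have "\<dots> \<le> (\<Sum>q\<in>Qs. 4 / (real n)\<^sup>2 * (8 * \<rho>\<^sup>2 + 18 * (1 / (cmod q)\<^sup>2)))"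
    proof (rule sum_mono)
      fix q assume q: "q \<in> Qs"
      have "real (card (P q)) \<le> (2 * (cmod q * \<rho> + 1) + 1)\<^sup>2"
        unfolding P_def by (rule gauss_ints_in_cball)
      \<comment> \<open>With \<open>a = cmod q * \<rho>\<close>, the squares of
        \<open>2 * a + 3\<close> and \<open>2 * a - 3\<close> add up to
        \<open>8 * a^2 + 18\<close>.\<close>
      also have "\<dots> \<le> 8 * \<rho>\<^sup>2 * (cmod q)\<^sup>2 + 18"
        using zero_le_power2[of "2 * (cmod q * \<rho>) - 3"] by (simp add: power2_eq_square algebra_simps)
      finally have "real (card (P q)) * (2 / (real n * cmod q))\<^sup>2
          \<le> (8 * \<rho>\<^sup>2 * (cmod q)\<^sup>2 + 18) * (2 / (real n * cmod q))\<^sup>2"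
        by (intro mult_right_mono) auto
      also have "\<dots> = 4 / (real n)\<^sup>2 * (8 * \<rho>\<^sup>2 + 18 * (1 / (cmod q)\<^sup>2))"
        using Qs0[OF q] n100 by (simp add: field_simps power2_eq_square)
      finally show "real (card (P q)) * (2 / (real n * cmod q))\<^sup>2
        \<le> 4 / (real n)\<^sup>2 * (8 * \<rho>\<^sup>2 + 18 * (1 / (cmod q)\<^sup>2))" .
    qed
    also have "\<dots> = 4 / (real n)\<^sup>2 * (8 * \<rho>\<^sup>2 * card Qs + 18 * (\<Sum>q\<in>Qs. 1 / (cmod q)\<^sup>2))"
      unfolding sum_distrib_left[symmetric] sum.distrib by simp
    also have "\<dots> \<le> 4 / (real n)\<^sup>2 * (8 * \<rho>\<^sup>2 * card Qs + 18 * (\<rho>\<^sup>2 * card Qs + (2 / \<rho> + 1)\<^sup>2))"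
      using finQ \<rho> by (intro mult_left_mono add_left_mono sum_inverse_norm_squared_le) (auto simp: Qs_def)
    also have "\<dots> = 4 / (real n)\<^sup>2 * (26 * \<rho>\<^sup>2 * card Qs + 18 * (2 / \<rho> + 1)\<^sup>2)"
      by (simp add: algebra_simps)
    also have "\<dots> \<le> 4 / (real n)\<^sup>2 * (26 * \<rho>\<^sup>2 * ((real n)\<^sup>2 * (9 / 10000)) + 18 * (3 / \<rho>)\<^sup>2)"
      using cardQ \<rho> by (intro mult_left_mono add_mono power_mono) (auto simp: field_simps)
    also have "\<dots> = \<rho>\<^sup>2 * (936 / 10000) + 648 / (real n * \<rho>)\<^sup>2"
      using n100 \<rho> by (simp add: field_simps power2_eq_square)
    \<comment> \<open>Here \<open>100 \<le> n * \<rho>^2\<close> turns the remaining error into a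
      small multiple of \<open>\<rho>^2\<close>.\<close>
    also have "648 / (real n * \<rho>)\<^sup>2 \<le> \<rho>\<^sup>2 * (648 / 10000)"
    proof -
      have "100 * 100 \<le> (real n * \<rho>\<^sup>2) * (real n * \<rho>\<^sup>2)" using n\<rho> by (intro mult_mono) auto
      then show ?thesis using n100 \<rho> by (simp add: field_simps power2_eq_square)
    qed
    also have "\<rho>\<^sup>2 * (936 / 10000) + \<rho>\<^sup>2 * (648 / 10000) \<le> \<rho>\<^sup>2 / 2" by simp
    finally show ?thesis by simp
  qed
  have "\<rho>\<^sup>2 \<le> (\<Sum>x\<in>Sigma Qs P. (2 / (real n * cmod (fst x)))\<^sup>2) + (\<Sum>g\<in>G. (200 / (real n)\<^sup>2)\<^sup>2)"
    by (rule radius_squared_le_of_cover[OF _ _ _ _ _ cover])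
      (use finQ finP finG \<rho> in auto)
  \<comment> \<open>At least half of the area is left to the discs around \<open>G\<close>, each
    contributing \<open>40000 / n^4\<close>; this produces the constant 80000.\<close>
  then have "\<rho>\<^sup>2 / 2 \<le> card G * (200 / (real n)\<^sup>2)\<^sup>2" using bad by simp
  then have "\<rho>\<^sup>2 * real n ^ 4 / 80000 \<le> real (card G)"
    using n100 by (simp add: field_simps power2_eq_square power4_eq_xxxx)
  then show thesis
    using finG sep by (intro that[of G]) (auto simp: G_def)
qed

subsection \<open>Upper bounds for the Hausdorff dimension\<close>

text \<open>A Borel-Cantelli argument: for every \<open>N\<close> the discs of the levels from
  \<open>N\<close> on cover \<open>E\<close>, their radii tend to 0, and their cost is the tail of a
  convergent series.\<close>

lemma hausdorff_measure_eq_0I: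
  fixes E :: "'a::euclidean_space set" and A :: "nat \<Rightarrow> 'a set" and \<rho> :: "nat \<Rightarrow> real"
  assumes fin: "\<And>j. finite (A j)" and nonneg: "\<And>j. 0 \<le> \<rho> j" and lim: "\<rho> \<longlonglongrightarrow> 0" and s: "0 < s"
    and summ: "summable (\<lambda>j. real (card (A j)) * (2 * \<rho> j) powr s)"
    and cover: "\<And>z N. z \<in> E \<Longrightarrow> \<exists>j\<ge>N. \<exists>a\<in>A j. dist a z \<le> \<rho> j"
  shows "hausdorff_measure s E = 0"
proof -
  have le: "hausdorff_premeasure s \<delta> E \<le> ennreal e" if "0 < \<delta>" "0 < e" for \<delta> e :: real
  proof -
    define t where "t = (\<lambda>j. real (card (A j)) * (2 * \<rho> j) powr s)"
    have t: "summable t" "\<And>j. 0 \<le> t j" using summ by (auto simp: t_def)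
    have "\<forall>\<^sub>F j in sequentially. \<rho> j < \<delta> / 2"
      using order_tendstoD(2)[OF lim, of "\<delta> / 2"] \<open>0 < \<delta>\<close> by simp
    then obtain N1 where N1: "\<And>j. N1 \<le> j \<Longrightarrow> \<rho> j < \<delta> / 2"
      by (auto simp: eventually_sequentially)
    obtain N2 where N2: "\<And>n. N2 \<le> n \<Longrightarrow> norm (\<Sum>i. t (i + n)) < e"
      using suminf_exist_split[OF \<open>0 < e\<close> t(1)] by auto
    define N where "N = max N1 N2"
    have "\<exists>f. bij_betw f {..<card (A j)} (A j)" for j
      using ex_bij_betw_nat_finite[OF fin[of j]] by (simp add: atLeast0LessThan)
    then obtain f where f: "\<And>j. bij_betw (f j) {..<card (A j)} (A j)" by metis
    \<comment> \<open>The premeasure asks for a sequence of sets: each level is padded with empty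
      sets, which cost 0, and \<open>prod_decode\<close> flattens the double sequence.\<close>
    define V where "V = (\<lambda>(j, k). if k < card (A (j + N)) then cball (f (j + N) k) (\<rho> (j + N)) else {})"
    define U where "U = (\<lambda>i. V (prod_decode i))"
    have bV: "bounded (V x)" for x by (cases x) (simp add: V_def)
    have dV: "diameter (V (j, k)) \<le> 2 * \<rho> (j + N)" for j k
      using nonneg by (simp add: V_def)
    have dV': "diameter (V (j, k)) \<le> \<delta>" for j k
    proof -
      have "N1 \<le> j + N" by (simp add: N_def)
      then show ?thesis using dV[of j k] N1[of "j + N"] by linarith
    qed
    have "E \<subseteq> (\<Union>i. U i)"
    proof
      fix z assume "z \<in> E"
      then obtain j a where ja: "N \<le> j" "a \<in> A j" "dist a z \<le> \<rho> j" using cover by blast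
      then obtain k where k: "k < card (A j)" "f j k = a"
        by (metis bij_betw_imp_surj_on[OF f] imageE lessThan_iff)
      then have "z \<in> V (j - N, k)" using ja by (simp add: V_def)
      then have "z \<in> U (prod_encode (j - N, k))" by (simp add: U_def)
      then show "z \<in> (\<Union>i. U i)" by blast
    qed
    moreover have "bounded (U i) \<and> diameter (U i) \<le> \<delta>" for i
      using bV dV' by (cases "prod_decode i") (simp add: U_def)
    ultimately have "hausdorff_premeasure s \<delta> E \<le> (\<Sum>i. diam_pow s (U i))"
      unfolding hausdorff_premeasure_def by (intro INF_lower) auto
    also have "\<dots> = (\<Sum>j. \<Sum>k. diam_pow s (V (j, k)))"
      unfolding U_def by (rule suminf_ennreal_2dimen) simp
    also have "\<dots> \<le> (\<Sum>j. ennreal (t (j + N)))"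
    proof (intro suminf_le allI summableI)
      fix j
      have "(\<Sum>k. diam_pow s (V (j, k))) = (\<Sum>k<card (A (j + N)). diam_pow s (V (j, k)))"
        by (rule suminf_finite) (auto simp: V_def diam_pow_def)
      also have "\<dots> \<le> (\<Sum>k<card (A (j + N)). ennreal ((2 * \<rho> (j + N)) powr s))"
        using dV s bV by (intro sum_mono) (auto simp: diam_pow_def intro!: ennreal_leI powr_mono2 diameter_ge_0)
      also have "\<dots> = ennreal (t (j + N))"
        by (simp add: t_def ennreal_mult ennreal_of_nat_eq_real_of_nat)
      finally show "(\<Sum>k. diam_pow s (V (j, k))) \<le> ennreal (t (j + N))" .
    qed
    also have "\<dots> = ennreal (\<Sum>j. t (j + N))"
      using t by (intro suminf_ennreal2) (auto simp: summable_iff_shift)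
    also have "\<dots> \<le> ennreal e"
      using N2[of N] by (intro ennreal_leI) (auto simp: N_def)
    finally show ?thesis .
  qed
  have "hausdorff_premeasure s \<delta> E \<le> 0" if "0 < \<delta>" for \<delta>
    by (rule ennreal_le_epsilon) (simp add: le that)
  then have "hausdorff_measure s E \<le> 0"
    unfolding hausdorff_measure_def by (intro SUP_least) auto
  then show ?thesis by simp
qed

text \<open>Comparison with a geometric series of ratio
  \<open>2 powr (a - b * s) < 1\<close>.\<close>

lemma summable_dyadic:
  fixes A :: "nat \<Rightarrow> 'b set" and \<rho> :: "nat \<Rightarrow> real"
  assumes A: "\<And>j. real (card (A j)) \<le> C * (2 powr a) ^ j" and \<rho>: "\<And>j. \<rho> j = D * (2 powr - b) ^ j"
    and "0 < D" "0 < s" "a < b * s"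
  shows "summable (\<lambda>j. real (card (A j)) * (2 * \<rho> j) powr s)"
proof (rule summable_comparison_test')
  show "summable (\<lambda>j. C * (2 * D) powr s * (2 powr (a - b * s)) ^ j)"
    using \<open>a < b * s\<close> by (intro summable_mult summable_geometric) (simp add: powr_less_one)
  show "norm (real (card (A j)) * (2 * \<rho> j) powr s) \<le> C * (2 * D) powr s * (2 powr (a - b * s)) ^ j" for j
  proof -
    have "(2 * \<rho> j) powr s = (2 * D) powr s * (2 powr (- b * s)) ^ j"
      using \<open>0 < D\<close> by (simp add: \<rho> powr_mult powr_realpow[symmetric] powr_powr mult_ac)
    then have "norm (real (card (A j)) * (2 * \<rho> j) powr s) \<le> C * (2 powr a) ^ j * ((2 * D) powr s * (2 powr (- b * s)) ^ j)"
      using A[of j] by (simp add: mult_right_mono)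
    also have "\<dots> = C * (2 * D) powr s * (2 powr (a - b * s)) ^ j"
      by (simp add: powr_diff powr_minus power_divide power_inverse divide_inverse power_mult_distrib mult_ac)
    finally show ?thesis .
  qed
qed

section \<open>Dyadic covers of the square and of the approximable points\<close>

lemma unit_square_norm_le:
  assumes "z \<in> unit_square" shows "cmod z \<le> 1"
proof -
  have "cmod z \<le> \<bar>Re z\<bar> + \<bar>Im z\<bar>" by (rule cmod_le)
  also have "\<dots> \<le> 1" using assms by (auto simp: unit_square_def)
  finally show ?thesis .
qed

text \<open>The grid of mesh \<open>2^-j\<close> gives \<open>O(4^j)\<close> discs of radius
  \<open>2 * 2^-j\<close>, so the costs are summable for \<open>s > 2\<close>.\<close>

lemma hausdorff_measure_unit_square_eq_0:
  assumes "2 < s" "E \<subseteq> unit_square"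
  shows "hausdorff_measure s E = 0"
proof -
  \<comment> \<open>Rounding \<open>2^j * z\<close> down moves it by at most 2, so the numerators
    have modulus at most \<open>2 + 2^j \<le> 3 * 2^j\<close>.\<close>
  define A where "A = (\<lambda>j. (\<lambda>p. p / 2 ^ j) ` (gauss_ints \<inter> cball 0 (3 * 2 ^ j)))"
  define \<rho> where "\<rho> = (\<lambda>j. 2 * (2 powr - 1) ^ j :: real)"
  show ?thesis
  proof (rule hausdorff_measure_eq_0I)
    show "finite (A j)" for j by (simp add: A_def gauss_ints_in_cball)
    show "0 \<le> \<rho> j" for j by (simp add: \<rho>_def)
    have "(\<lambda>j. (2 powr - 1 :: real) ^ j) \<longlonglongrightarrow> 0" by (intro LIMSEQ_power_zero) (simp add: powr_minus)
    then show "\<rho> \<longlonglongrightarrow> 0" unfolding \<rho>_def by (intro tendsto_mult_right_zero)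
    show "summable (\<lambda>j. real (card (A j)) * (2 * \<rho> j) powr s)"
    proof (rule summable_dyadic[where D = 2 and b = 1])
      show "real (card (A j)) \<le> 49 * (2 powr 2) ^ j" for j
      proof -
        have "real (card (A j)) \<le> card (gauss_ints \<inter> cball 0 (3 * 2 ^ j))"
          by (simp add: A_def card_image_le gauss_ints_in_cball)
        also have "\<dots> \<le> (2 * (3 * 2 ^ j) + 1)\<^sup>2" by (rule gauss_ints_in_cball)
        also have "\<dots> \<le> (7 * 2 ^ j)\<^sup>2" by (intro power_mono) auto
        also have "\<dots> = 49 * (2 powr 2) ^ j" by (simp add: power_mult_distrib power_mult[symmetric] mult.commute[of j]) (simp add: power_mult)
        finally show ?thesis .
      qed
    qed (use assms in \<open>auto simp: \<rho>_def\<close>)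
    show "\<exists>j\<ge>N. \<exists>a\<in>A j. dist a z \<le> \<rho> j" if "z \<in> E" for z N
    proof (intro exI[of _ N] conjI bexI)
      define p where "p = Complex (of_int \<lfloor>2 ^ N * Re z\<rfloor>) (of_int \<lfloor>2 ^ N * Im z\<rfloor>)"
      have "cmod (p - 2 ^ N * z) \<le> \<bar>Re (p - 2 ^ N * z)\<bar> + \<bar>Im (p - 2 ^ N * z)\<bar>" by (rule cmod_le)
      also have "Re (p - 2 ^ N * z) = of_int \<lfloor>2 ^ N * Re z\<rfloor> - 2 ^ N * Re z"
        by (simp add: p_def Re_power_real Im_power_real)
      also have "Im (p - 2 ^ N * z) = of_int \<lfloor>2 ^ N * Im z\<rfloor> - 2 ^ N * Im z"
        by (simp add: p_def Re_power_real Im_power_real)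
      also have "\<bar>of_int \<lfloor>2 ^ N * Re z\<rfloor> - 2 ^ N * Re z\<bar> + \<bar>of_int \<lfloor>2 ^ N * Im z\<rfloor> - 2 ^ N * Im z\<bar> \<le> 2"
        by linarith
      finally have p: "cmod (p - 2 ^ N * z) \<le> 2" .
      have "cmod p \<le> cmod (p - 2 ^ N * z) + cmod (2 ^ N * z)"
        using norm_triangle_ineq[of "p - 2 ^ N * z" "2 ^ N * z"] by simp
      also have "cmod (2 ^ N * z) \<le> 2 ^ N"
        using unit_square_norm_le[of z] that assms(2) by (auto simp: norm_mult norm_power)
      finally have "cmod p \<le> 2 + 2 ^ N" using p by simp
      also have "\<dots> \<le> 3 * 2 ^ N" by simp
      finally show "p / 2 ^ N \<in> A N" by (auto simp: A_def p_def)
      have "dist (p / 2 ^ N) z = cmod (p - 2 ^ N * z) / 2 ^ N"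
      proof -
        have "p / 2 ^ N - z = (p - 2 ^ N * z) / 2 ^ N" by (simp add: field_simps)
        then show ?thesis by (simp add: dist_norm norm_divide norm_power)
      qed
      also have "\<dots> \<le> 2 / 2 ^ N" using p by (intro divide_right_mono) auto
      also have "\<dots> = \<rho> N" 
      proof -
        have "2 powr - 1 = (1 / 2 :: real)" by (simp add: powr_minus_divide)
        then show ?thesis unfolding \<rho>_def by (simp only: power_one_over)
      qed
      finally show "dist (p / 2 ^ N) z \<le> \<rho> N" .
    qed simp
  qed (use assms in auto)
qed

text \<open>A bounded denominator forces a bounded numerator, so infinitely many admissible pairs
  include arbitrarily large denominators. Hence every approximable point lies in discs of
  arbitrarily high dyadic level.\<close>

lemma hausdorff_measure_approximable_eq_0:
  assumes mono: "antimono_on {0<..} \<psi>" and b: "0 < b" "4 < b * s" and s: "0 < s"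
    and ev: "\<And>x. X \<le> x \<Longrightarrow> \<psi> x \<le> x powr - b"
  shows "hausdorff_measure s (approximable_set \<psi>) = 0"
proof -
  \<comment> \<open>At level \<open>j\<close>, \<open>cmod q < 2 * 2^j\<close>; together with
    \<open>\<psi> (cmod q) \<le> 1\<close> this gives \<open>cmod p \<le> 4 * 2^j\<close>. The pairs
    number \<open>O(4^j * 4^j)\<close>, whence the exponent 4.\<close>
  define A where "A = (\<lambda>j. (\<lambda>(p, q). p / q) `
      ((gauss_ints \<inter> cball 0 (4 * 2 ^ j)) \<times> (gauss_ints \<inter> cball (0::complex) (2 * 2 ^ j))))"
  define \<rho> where "\<rho> = (\<lambda>j. 1 * (2 powr - b) ^ j :: real)"
  show ?thesis
  proof (rule hausdorff_measure_eq_0I)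
    show "finite (A j)" for j by (simp add: A_def gauss_ints_in_cball)
    show "0 \<le> \<rho> j" for j by (simp add: \<rho>_def)
    have "(\<lambda>j. (2 powr - b) ^ j) \<longlonglongrightarrow> 0" using b by (intro LIMSEQ_power_zero) (simp add: powr_less_one)
    then show "\<rho> \<longlonglongrightarrow> 0" by (simp add: \<rho>_def)
    show "summable (\<lambda>j. real (card (A j)) * (2 * \<rho> j) powr s)"
    proof (rule summable_dyadic[where D = 1 and b = b])
      show "real (card (A j)) \<le> 9\<^sup>2 * 5\<^sup>2 * (2 powr 4) ^ j" for j
      proof -
        have "real (card (A j)) \<le> card ((gauss_ints \<inter> cball 0 (4 * 2 ^ j)) \<times> (gauss_ints \<inter> cball (0::complex) (2 * 2 ^ j)))"
          unfolding A_def of_nat_le_iff by (intro card_image_le) (simp add: gauss_ints_in_cball)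
        also have "\<dots> \<le> (2 * (4 * 2 ^ j) + 1)\<^sup>2 * (2 * (2 * 2 ^ j) + 1)\<^sup>2"
          unfolding card_cartesian_product of_nat_mult by (intro mult_mono gauss_ints_in_cball) auto
        also have "\<dots> \<le> (9 * 2 ^ j)\<^sup>2 * (5 * 2 ^ j)\<^sup>2" by (intro mult_mono power_mono) auto
        also have "\<dots> = 9\<^sup>2 * 5\<^sup>2 * ((2 ^ j)\<^sup>2 * (2 ^ j)\<^sup>2)" by (simp add: power_mult_distrib)
        also have "((2 ^ j)\<^sup>2 * (2 ^ j)\<^sup>2 :: real) = (2 powr 4) ^ j"
          by (simp add: power_mult_distrib[symmetric] power2_eq_square)
        finally show ?thesis .
      qed
    qed (use assms in \<open>auto simp: \<rho>_def\<close>)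
    show "\<exists>j\<ge>N. \<exists>a\<in>A j. dist a z \<le> \<rho> j" if z: "z \<in> approximable_set \<psi>" for z N
    proof -
      let ?T = "{(p, q). p \<in> gauss_ints \<and> q \<in> gauss_ints \<and> q \<noteq> 0 \<and> cmod (z - p / q) \<le> \<psi> (cmod q)}"
      have inf: "infinite ?T" and z1: "cmod z \<le> 1"
        using z unit_square_norm_le by (auto simp: approximable_set_def)
      \<comment> \<open>\<open>2^N\<close> makes the level at least \<open>N\<close>, and
        \<open>X\<close> makes the bound on \<open>\<psi>\<close> available. \<open>K\<close> bounds
        the numerators belonging to denominators up to \<open>M\<close>, as
        \<open>\<psi> (cmod q) \<le> \<psi> 1\<close>.\<close>
      define M where "M = max (2 ^ N) (max 1 X)"
      define K where "K = M * (1 + \<psi> 1)"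
      have pbound: "cmod p \<le> cmod q * (1 + \<psi> (cmod q))" if "(p, q) \<in> ?T" for p q
      proof -
        have "cmod (p / q) \<le> cmod z + cmod (z - p / q)"
          using norm_triangle_ineq4[of z "z - p / q"] by simp
        also have "\<dots> \<le> 1 + \<psi> (cmod q)" using z1 that by auto
        finally show ?thesis using that by (auto simp: norm_divide field_simps)
      qed
      have "\<exists>p q. (p, q) \<in> ?T \<and> M \<le> cmod q"
      proof (rule ccontr)
        assume neg: "\<not> ?thesis"
        have "?T \<subseteq> (gauss_ints \<inter> cball 0 K) \<times> (gauss_ints \<inter> cball 0 M)"
        proof (clarify, intro conjI SigmaI IntI)
          fix p q assume h: "p \<in> gauss_ints" "q \<in> gauss_ints" "q \<noteq> 0" "cmod (z - p / q) \<le> \<psi> (cmod q)"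
          have q1: "1 \<le> cmod q" using h gauss_ints_norm_ge_1 by blast
          have qM: "cmod q \<le> M" using neg h by force
          then show "q \<in> cball 0 M" by simp
          have \<psi>1: "\<psi> (cmod q) \<le> \<psi> 1" using q1 by (intro monotone_onD[OF mono]) auto
          have "0 \<le> \<psi> (cmod q)" using h(4) norm_ge_zero order_trans by blast
          then have "cmod q * (1 + \<psi> (cmod q)) \<le> K"
            unfolding K_def using qM \<psi>1 q1 by (intro mult_mono) auto
          with pbound[of p q] h show "p \<in> cball 0 K" by auto
        qed auto
        then show False using inf finite_subset gauss_ints_in_cball(1) by blast
      qed
      then obtain p q where pq: "(p, q) \<in> ?T" and Mq: "M \<le> cmod q" by blast
      have q: "1 \<le> cmod q" "X \<le> cmod q" "2 ^ N \<le> cmod q" "0 < cmod q" using Mq pq by (auto simp: M_def)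
      \<comment> \<open>The dyadic level of \<open>q\<close>, with
        \<open>2^j \<le> cmod q < 2^(j+1)\<close>.\<close>
      define j where "j = nat \<lfloor>log 2 (cmod q)\<rfloor>"
      have log0: "0 \<le> log 2 (cmod q)" using q by simp
      have "real j \<le> log 2 (cmod q)" "log 2 (cmod q) < real j + 1"
        using log0 by (simp_all add: j_def)
      then have j: "2 ^ j \<le> cmod q" "cmod q < 2 * 2 ^ j"
        using q by (auto simp: le_log_iff log_less_iff powr_add powr_realpow)
      have "real N \<le> log 2 (cmod q)" using q by (simp add: le_log_iff powr_realpow)
      then have "N \<le> j" unfolding j_def by linarith
      have \<psi>q: "\<psi> (cmod q) \<le> cmod q powr - b" using ev q by blast
      also have "\<dots> \<le> (2 ^ j) powr - b" using j q b by (intro powr_mono2') auto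
      also have "\<dots> = \<rho> j" by (simp add: \<rho>_def powr_realpow[symmetric] powr_powr mult.commute)
      finally have \<rho>: "\<psi> (cmod q) \<le> \<rho> j" .
      have \<psi>0: "0 \<le> \<psi> (cmod q)"
        using order_trans[OF norm_ge_zero[of "z - p / q"]] pq by blast
      have "\<psi> (cmod q) \<le> 1"
        using \<psi>q q b powr_mono2'[of "- b" 1 "cmod q"] by simp
      then have "cmod q * (1 + \<psi> (cmod q)) \<le> (2 * 2 ^ j) * 2"
        using j q \<psi>0 by (intro mult_mono) auto
      then have "cmod p \<le> 4 * 2 ^ j" using pbound[OF pq] by simp
      then have "p / q \<in> A j" using pq j by (force simp: A_def)
      moreover have "dist (p / q) z \<le> \<rho> j" using pq \<rho> by (auto simp: dist_norm norm_minus_commute)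
      ultimately show ?thesis using \<open>N \<le> j\<close> by blast
    qed
  qed (use s in auto)
qed

subsection \<open>The lower bound for the Hausdorff dimension\<close>

text \<open>
  If the terms for \<open>cball y r\<close> sum to less than 1, then no covering ball \<open>cball (x i) (\<rho> i)\<close> with
  \<open>\<rho> i \<ge> r\<close> meets \<open>cball y r\<close>; the smaller ones are weighted so that the bound can be passed on to a subdisc.
\<close>

definition load_term :: "(nat \<Rightarrow> complex) \<Rightarrow> (nat \<Rightarrow> real) \<Rightarrow> real \<Rightarrow> real \<Rightarrow> complex \<Rightarrow> real \<Rightarrow> nat \<Rightarrow> real" where
  "load_term x \<rho> c s y r i =
     (if dist y (x i) \<le> r + \<rho> i then (if r \<le> \<rho> i then 1 else \<rho> i powr s / (c * r powr s)) else 0)"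

section \<open>Loads of discs and the averaging step\<close>

lemma load_term_nonneg: "0 < c \<Longrightarrow> 0 \<le> load_term x \<rho> c s y r i"
  by (simp add: load_term_def)

text \<open>Used for summability and for the load of the initial disc. For a ball with
  \<open>r \<le> \<rho> i\<close> the right-hand side is at least 1.\<close>

lemma load_term_le:
  assumes "0 < c" "c \<le> 1" "0 < r" "0 \<le> s" "0 < \<rho> i"
  shows "load_term x \<rho> c s y r i \<le> \<rho> i powr s / (c * r powr s)"
proof -
  have "1 \<le> \<rho> i powr s / (c * r powr s)" if "r \<le> \<rho> i"
  proof -
    have "c * r powr s \<le> 1 * \<rho> i powr s"
      using assms that by (intro mult_mono powr_mono2) auto
    then show ?thesis using assms by simp
  qed
  then show ?thesis using assms by (simp add: load_term_def)
qed

lemma summable_load_term: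
  assumes "0 < c" "c \<le> 1" "0 < r" "0 \<le> s" "\<And>i. 0 < \<rho> i" "summable (\<lambda>i. \<rho> i powr s)"
  shows "summable (load_term x \<rho> c s y r)"
proof (rule summable_comparison_test')
  show "summable (\<lambda>i. \<rho> i powr s / (c * r powr s))" using assms by (intro summable_divide)
  show "norm (load_term x \<rho> c s y r i) \<le> \<rho> i powr s / (c * r powr s)" for i
    using assms load_term_le[of c r s \<rho> i x y] load_term_nonneg[of c x \<rho> s y r i] by simp
qed

text \<open>Averaging: the loads of all children add up to at most \<open>?K\<close> times the load
  of the parent. Since \<open>?K \<le> card G\<close> and the parent has load below 1, some child
  does too.\<close>

lemma light_child_exists:
  fixes x :: "nat \<Rightarrow> complex"
  assumes c: "0 < c" "c \<le> 1" and s: "0 < s" "s \<le> 2" and r: "0 < r" and r': "0 < r'" "r' \<le> r / 2"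
    and \<rho>: "\<And>i. 0 < \<rho> i" and summ: "summable (\<lambda>i. \<rho> i powr s)"
    and light: "suminf (load_term x \<rho> c s y r) < 1"
    and G: "finite G" "G \<subseteq> cball y (r / 2)" and d: "0 < d" "8 * r' \<le> d"
    and sep: "\<And>g h. g \<in> G \<Longrightarrow> h \<in> G \<Longrightarrow> g \<noteq> h \<Longrightarrow> d \<le> dist g h"
    and many: "16 * c * r\<^sup>2 / d\<^sup>2 \<le> card G"
    and small: "5 * r powr s / r' powr s \<le> 8 * c * r\<^sup>2 / d\<^sup>2"
  obtains g where "g \<in> G" "suminf (load_term x \<rho> c s g r') < 1"
proof -
  let ?u = "load_term x \<rho> c s y r"
  \<comment> \<open>The first summand accounts for the boundedly many children that even a tiny ball
    can meet, the second for the number of children growing with the area of the ball.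
    \<open>small\<close> bounds the first by the second, and \<open>many\<close> bounds twice the
    second by \<open>card G\<close>.\<close>
  let ?K = "5 * r powr s / r' powr s + 8 * c * r\<^sup>2 / d\<^sup>2"
  have su: "summable ?u" using assms by (intro summable_load_term) auto
  have sv: "summable (load_term x \<rho> c s g r')" for g using assms by (intro summable_load_term) auto
  have ul: "?u i < 1" for i
  proof -
    have "?u i \<le> suminf ?u"
      using sum_le_suminf[OF su, of "{i}"] load_term_nonneg c by auto
    then show ?thesis using light by simp
  qed
  have "0 < ?K" using c r r' d by (intro add_pos_pos) auto
  have child_sum: "(\<Sum>g\<in>G. load_term x \<rho> c s g r' i) \<le> ?K * ?u i" for i
  proof (cases "dist y (x i) \<le> r + \<rho> i")
    case False
    have "load_term x \<rho> c s g r' i = 0" if "g \<in> G" for g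
    proof -
      \<comment> \<open>The child disc lies inside the parent disc, so a ball missing the parent
        misses the child.\<close>
      have "dist y g \<le> r / 2" using G that by auto
      then have "\<not> dist g (x i) \<le> r' + \<rho> i"
        using False r' dist_triangle[of y "x i" g] by linarith
      then show ?thesis by (simp add: load_term_def)
    qed
    then show ?thesis using \<open>0 < ?K\<close> load_term_nonneg c by simp
  next
    case True
    \<comment> \<open>A meeting ball with \<open>r \<le> \<rho> i\<close> would have term 1,
      contradicting \<open>ul\<close>.\<close>
    have lt: "\<rho> i < r" using ul[of i] True by (auto simp: load_term_def split: if_splits)
    have u: "?u i = \<rho> i powr s / (c * r powr s)" using True lt by (simp add: load_term_def)
    \<comment> \<open>The children met by the \<open>i\<close>-th ball; all of them receive the same
      term \<open>v\<close>.\<close>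
    let ?H = "G \<inter> cball (x i) (r' + \<rho> i)"
    define v where "v = (if r' \<le> \<rho> i then 1 else \<rho> i powr s / (c * r' powr s))"
    have "(\<Sum>g\<in>G. load_term x \<rho> c s g r' i) = (\<Sum>g\<in>G. if g \<in> ?H then v else 0)"
      by (intro sum.cong) (auto simp: load_term_def v_def dist_commute)
    also have "\<dots> = card ?H * v"
      using G by (simp add: sum.If_cases Int_def)
    finally have eq: "(\<Sum>g\<in>G. load_term x \<rho> c s g r' i) = card ?H * v" .
    have "real (card ?H) \<le> (2 * (r' + \<rho> i) / d + 1)\<^sup>2"
      by (rule card_separated_le[where w = "x i"]) (use d sep in auto)
    \<comment> \<open>\<open>8 * r' \<le> d\<close> absorbs the child radius into the constant
      \<open>5 / 4\<close>.\<close>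
    also have "\<dots> \<le> (2 * (\<rho> i / d) + 5 / 4)\<^sup>2"
      using d r' \<rho>[of i] by (intro power_mono) (auto simp: field_simps)
    also have "\<dots> \<le> 4 + 8 * (\<rho> i / d)\<^sup>2"
      using zero_le_power2[of "2 * (\<rho> i / d) - 5 / 4"] by (simp add: power2_eq_square algebra_simps)
    finally have card: "real (card ?H) \<le> 4 + 8 * (\<rho> i / d)\<^sup>2" .
    have v0: "0 \<le> v" using c by (simp add: v_def)
    have "card ?H * v \<le> 5 * \<rho> i powr s / (c * r' powr s) + 8 * \<rho> i powr s * r powr (2 - s) / d\<^sup>2"
    \<comment> \<open>For \<open>r' \<le> \<rho> i\<close> the term is 1 and
      \<open>\<rho> i < r\<close>, \<open>s \<le> 2\<close> trade \<open>(\<rho> i)^2\<close> for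
      \<open>\<rho> i powr s * r powr (2 - s)\<close>. A smaller ball meets at most 5
      children.\<close>
    proof (cases "r' \<le> \<rho> i")
      case True
      have "r' powr s * c \<le> \<rho> i powr s * 1"
        using True c s r' by (intro mult_mono powr_mono2) auto
      then have 1: "1 \<le> \<rho> i powr s / (c * r' powr s)" using c r' by (simp add: mult.commute)
      have "(\<rho> i)\<^sup>2 = \<rho> i powr s * \<rho> i powr (2 - s)"
        using \<rho>[of i] by (simp add: powr_add[symmetric] powr_numeral)
      also have "\<dots> \<le> \<rho> i powr s * r powr (2 - s)"
        using lt \<rho>[of i] s by (intro mult_left_mono powr_mono2) auto
      finally have "8 * (\<rho> i / d)\<^sup>2 \<le> 8 * \<rho> i powr s * r powr (2 - s) / d\<^sup>2"
        using d by (simp add: power_divide divide_right_mono)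
      then show ?thesis using card 1 True by (simp add: v_def)
    next
      case False
      have "\<rho> i / d \<le> 1 / 8" using False d \<rho>[of i] by (simp add: field_simps)
      then have "(\<rho> i / d)\<^sup>2 \<le> (1 / 8)\<^sup>2" using d \<rho>[of i] by (intro power_mono) auto
      also have "(1 / 8 :: real)\<^sup>2 \<le> 1 / 8" by (simp add: power2_eq_square)
      finally have "real (card ?H) \<le> 5" using card by linarith
      then have "card ?H * v \<le> 5 * v" using v0 by (rule mult_right_mono)
      also have "\<dots> = 5 * \<rho> i powr s / (c * r' powr s)" using False by (simp add: v_def)
      also have "\<dots> \<le> 5 * \<rho> i powr s / (c * r' powr s) + 8 * \<rho> i powr s * r powr (2 - s) / d\<^sup>2"
        using d by simp
      finally show ?thesis .
    qed
    also have "\<dots> = ?K * ?u i"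
    proof -
      have "r\<^sup>2 = r powr s * r powr (2 - s)"
        using r by (simp add: powr_add[symmetric] powr_numeral)
      then show ?thesis using c r r' d by (simp add: u field_simps)
    qed
    finally show ?thesis using eq by simp
  qed
  have "(\<Sum>g\<in>G. suminf (load_term x \<rho> c s g r')) = (\<Sum>i. \<Sum>g\<in>G. load_term x \<rho> c s g r' i)"
    by (rule suminf_sum[symmetric]) (rule sv)
  also have "\<dots> \<le> (\<Sum>i. ?K * ?u i)"
    by (intro suminf_le child_sum summable_sum sv summable_mult su)
  also have "\<dots> = ?K * suminf ?u" by (rule suminf_mult[OF su])
  also have "\<dots> < ?K * 1" using light \<open>0 < ?K\<close> by (intro mult_strict_left_mono)
  also have "\<dots> \<le> card G" using small many by simp
  finally have "(\<Sum>g\<in>G. suminf (load_term x \<rho> c s g r')) < (\<Sum>g\<in>G. 1)" by simp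
  then obtain g where "g \<in> G" "suminf (load_term x \<rho> c s g r') < 1"
    by (meson not_less sum_mono)
  then show thesis by (rule that)
qed

text \<open>Replaces infinitude by arbitrarily close admissible fractions. If \<open>z\<close> is
  itself a fraction, the multiples of one representation are infinitely many pairs; otherwise
  finitely many pairs would have a positive least distance to \<open>z\<close>.\<close>

lemma approximable_setI:
  assumes z: "z \<in> unit_square - {0}" and pos: "\<And>x. 0 < x \<Longrightarrow> 0 < \<psi> x"
    and approx: "\<And>e. 0 < e \<Longrightarrow> \<exists>p\<in>gauss_ints. \<exists>q\<in>gauss_ints. q \<noteq> 0 \<and>
        cmod (z - p / q) \<le> \<psi> (cmod q) \<and> cmod (z - p / q) < e"
  shows "z \<in> approximable_set \<psi>"
proof -
  let ?T = "{(p, q). p \<in> gauss_ints \<and> q \<in> gauss_ints \<and> q \<noteq> 0 \<and> cmod (z - p / q) \<le> \<psi> (cmod q)}"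
  have "infinite ?T"
  proof (cases "\<exists>p\<in>gauss_ints. \<exists>q\<in>gauss_ints. q \<noteq> 0 \<and> z = p / q")
    case True
    then obtain p q where pq: "p \<in> gauss_ints" "q \<in> gauss_ints" "q \<noteq> 0" "z = p / q" by blast
    have "(\<lambda>n. (of_nat (Suc n) * p, of_nat (Suc n) * q)) ` UNIV \<subseteq> ?T"
    proof clarify
      fix n
      have "0 < cmod (of_nat (Suc n) * q)" using pq by (simp del: of_nat_Suc)
      then have "0 < \<psi> (cmod (of_nat (Suc n) * q))" by (rule pos)
      then show "of_nat (Suc n) * p \<in> gauss_ints \<and> of_nat (Suc n) * q \<in> gauss_ints \<and> of_nat (Suc n) * q \<noteq> 0
          \<and> cmod (z - of_nat (Suc n) * p / (of_nat (Suc n) * q)) \<le> \<psi> (cmod (of_nat (Suc n) * q))"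
        using pq by (auto intro: gauss_ints_mult simp del: of_nat_Suc)
    qed
    moreover have "inj (\<lambda>n. (of_nat (Suc n) * p, of_nat (Suc n) * q))"
      using pq by (intro injI) (simp del: of_nat_Suc)
    ultimately show ?thesis using finite_subset finite_imageD infinite_UNIV_nat by blast
  next
    case False
    show ?thesis
    proof
      assume fin: "finite ?T"
      let ?e = "Min ((\<lambda>(p, q). cmod (z - p / q)) ` ?T)"
      have ne: "?T \<noteq> {}" using approx[of 1] by auto
      have "0 < ?e" using fin ne False by (subst Min_gr_iff) auto
      then obtain p q where pq: "(p, q) \<in> ?T" "cmod (z - p / q) < ?e" using approx[of ?e] by blast
      have "?e \<le> cmod (z - p / q)" using fin pq(1) by (intro Min_le) force+
      with pq show False by simp
    qed
  qed
  then show ?thesis using z by (simp add: approximable_set_def)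
qed

text \<open>A fixed disc away from 0 in which both lower-bound constructions take place.\<close>

lemma cball_subset_punctured_square: "cball (1 / 4) (1 / 8) \<subseteq> unit_square - {0}"
proof
  fix z :: complex assume "z \<in> cball (1 / 4) (1 / 8)"
  then have "cmod (1 / 4 - z) \<le> 1 / 8" by (simp add: dist_norm)
  moreover have "Re (1 / 4 - z) = 1 / 4 - Re z" "Im (1 / 4 - z) = - Im z" by simp_all
  ultimately have "\<bar>1 / 4 - Re z\<bar> \<le> 1 / 8" "\<bar>- Im z\<bar> \<le> 1 / 8"
    using abs_Re_le_cmod[of "1 / 4 - z"] abs_Im_le_cmod[of "1 / 4 - z"] by linarith+
  then have "1 / 8 \<le> Re z" "Re z < 1 / 2" "- 1 / 2 \<le> Im z" "Im z < 1 / 2"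
    unfolding abs_le_iff by linarith+
  then show "z \<in> unit_square - {0}" by (auto simp: unit_square_def)
qed

text \<open>
  \<open>16 light_const = 1 / (4\<^sup>2 * 4\<^sup>2 * 80000)\<close>, so that the count in \<open>many_separated_fractions\<close> for the
  radius \<open>r / 4\<close> is the one required by \<open>light_child_exists\<close> with \<open>d = 1 / (4 n\<^sup>2)\<close>.
\<close>

definition light_const :: real where "light_const = 1 / 327680000"

text \<open>Pick a large \<open>t\<close> with \<open>t powr - b < \<psi> t\<close> and use
  denominators up to \<open>2 * n \<le> t\<close>. Monotonicity of \<open>\<psi>\<close> makes the
  radius \<open>t powr - b\<close> admissible for all these fractions at once, and
  \<open>light_child_exists\<close> selects one.\<close>

lemma light_step:
  fixes x :: "nat \<Rightarrow> complex"
  assumes mono: "antimono_on {0<..} \<psi>" and s: "0 < s" "s \<le> 2" and b: "2 < b" "b * s < 4"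
    and freq: "\<And>X. \<exists>t\<ge>X. t powr - b < \<psi> t"
    and \<rho>: "\<And>i. 0 < \<rho> i" and summ: "summable (\<lambda>i. \<rho> i powr s)"
    and r: "0 < r" "r \<le> 1" and light: "suminf (load_term x \<rho> light_const s y r) < 1"
  obtains y' r' p q where "0 < r'" "r' \<le> r / 2" "dist y y' \<le> r / 2"
    "suminf (load_term x \<rho> light_const s y' r') < 1"
    "p \<in> gauss_ints" "q \<in> gauss_ints" "q \<noteq> 0" "y' = p / q" "r' \<le> \<psi> (cmod q)"
proof -
  let ?c = light_const
  have c: "0 < ?c" "?c \<le> 1" by (simp_all add: light_const_def)
  have lim: "((\<lambda>t::real. t powr e) \<longlongrightarrow> 0) at_top" if "e < 0" for e
    using that by (intro tendsto_neg_powr filterlim_ident)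
  \<comment> \<open>The four conditions on \<open>t\<close> serve in turn:
    \<open>8 * r' \<le> d\<close>, \<open>r' \<le> r / 2\<close>, the hypothesis
    \<open>small\<close>, and \<open>n\<close> large enough for the count at radius
    \<open>r / 4\<close>. The assumptions on \<open>b\<close> make the exponents negative.\<close>
  have "\<forall>\<^sub>F t in at_top. t powr (2 - b) < 1 / 8"
    by (rule order_tendstoD(2)[OF lim]) (use b in auto)
  moreover have "\<forall>\<^sub>F t in at_top. t powr - b < r / 2"
    by (rule order_tendstoD(2)[OF lim]) (use b r in auto)
  moreover have "\<forall>\<^sub>F t in at_top. t powr (b * s - 4) < ?c * r\<^sup>2 / (10 * r powr s)"
    by (rule order_tendstoD(2)[OF lim]) (use b r c in auto)
  moreover have "\<forall>\<^sub>F t in at_top. 4 + 3200 / r\<^sup>2 \<le> t" by (rule eventually_ge_at_top)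
  ultimately have "\<forall>\<^sub>F t in at_top. t powr (2 - b) < 1 / 8 \<and> t powr - b < r / 2 \<and>
      t powr (b * s - 4) < ?c * r\<^sup>2 / (10 * r powr s) \<and> 4 + 3200 / r\<^sup>2 \<le> t"
    by eventually_elim auto
  then obtain X where X: "\<And>t. X \<le> t \<Longrightarrow> t powr (2 - b) < 1 / 8 \<and> t powr - b < r / 2 \<and>
      t powr (b * s - 4) < ?c * r\<^sup>2 / (10 * r powr s) \<and> 4 + 3200 / r\<^sup>2 \<le> t"
    by (auto simp: eventually_at_top_linorder)
  obtain t where "X \<le> t" and \<psi>t: "t powr - b < \<psi> t" using freq by blast
  then have t: "t powr (2 - b) < 1 / 8" "t powr - b < r / 2"
      "t powr (b * s - 4) < ?c * r\<^sup>2 / (10 * r powr s)" "4 + 3200 / r\<^sup>2 \<le> t"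
    using X by auto
  have "0 \<le> 3200 / r\<^sup>2" by simp
  then have t4: "4 \<le> t" using t(4) by linarith
  define n where "n = nat \<lfloor>t / 2\<rfloor>"
  have n: "2 * real n \<le> t" "t / 2 - 1 < real n" using t4 by (auto simp: n_def) linarith+
  then have nt: "t / 4 \<le> real n" "1 < real n" using t4 by auto
  define r' where "r' = t powr - b"
  define d where "d = 1 / (4 * (real n)\<^sup>2)"
  have r': "0 < r'" "r' \<le> r / 2" using t4 t(2) by (auto simp: r'_def)
  have "100 / (r / 4)\<^sup>2 = 1600 / r\<^sup>2" by (simp add: power_divide)
  also have "\<dots> \<le> t / 2 - 1" using t(4) by simp
  also have "\<dots> \<le> n" using n by simp
  finally have "100 / (r / 4)\<^sup>2 \<le> n" .
  then obtain G where G: "finite G" "G \<subseteq> cball y (2 * (r / 4))" "(r / 4)\<^sup>2 * real n ^ 4 / 80000 \<le> real (card G)"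
    and frac: "\<And>g. g \<in> G \<Longrightarrow> \<exists>p\<in>gauss_ints. \<exists>q\<in>gauss_ints. q \<noteq> 0 \<and> cmod q \<le> 2 * real n \<and> g = p / q"
    and sep: "\<And>g h. g \<in> G \<Longrightarrow> h \<in> G \<Longrightarrow> g \<noteq> h \<Longrightarrow> d \<le> dist g h"
    using many_separated_fractions[of "r / 4" n y] r unfolding d_def by auto
  have d: "0 < d" using nt by (simp add: d_def)
  have d2: "1 / d\<^sup>2 = 16 * real n ^ 4" by (simp add: d_def power_divide power_mult_distrib power_mult[symmetric])
  have "t powr 2 * r' < 1 / 8" using t(1) by (simp add: r'_def powr_add[symmetric])
  then have "8 * r' \<le> 1 / t\<^sup>2" using t4 by (simp add: powr_numeral field_simps)
  also have "\<dots> \<le> d"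
  proof -
    have "(2 * real n)\<^sup>2 \<le> t\<^sup>2" using n by (intro power_mono) auto
    then show ?thesis using nt t4 unfolding d_def by (intro divide_left_mono mult_pos_pos) (auto simp: power_mult_distrib)
  qed
  finally have "8 * r' \<le> d" .
  have many: "16 * ?c * r\<^sup>2 / d\<^sup>2 \<le> card G"
  proof -
    have "16 * ?c * r\<^sup>2 / d\<^sup>2 = 16 * ?c * r\<^sup>2 * (1 / d\<^sup>2)" by simp
    also have "\<dots> = (r / 4)\<^sup>2 * real n ^ 4 / 80000"
      unfolding d2 by (simp add: light_const_def power_divide)
    finally show ?thesis using G(3) by simp
  qed
  have small: "5 * r powr s / r' powr s \<le> 8 * ?c * r\<^sup>2 / d\<^sup>2"
  proof -
    have "r' powr s = t powr (- (b * s))" by (simp add: r'_def powr_powr)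
    then have "5 * r powr s / r' powr s = 5 * r powr s * t powr (b * s)"
      by (simp add: powr_minus_divide)
    also have "t powr (b * s) = t powr (b * s - 4) * t ^ 4"
      using t4 by (simp add: powr_diff powr_numeral)
    also have "\<dots> \<le> ?c * r\<^sup>2 / (10 * r powr s) * t ^ 4"
      using t(3) by (intro mult_right_mono) auto
    also have "5 * r powr s * (?c * r\<^sup>2 / (10 * r powr s) * t ^ 4) = ?c * r\<^sup>2 * (t ^ 4 / 2)"
      using r by (simp add: field_simps)
    \<comment> \<open>From \<open>t / 4 \<le> n\<close>, since
      \<open>4^4 / 2 = 8 * 16\<close>.\<close>
    also have "t ^ 4 / 2 \<le> 8 * (16 * real n ^ 4)"
    proof -
      have "(t / 4) ^ 4 \<le> real n ^ 4" using nt t4 by (intro power_mono) auto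
      then show ?thesis by (simp add: power_divide)
    qed
    finally have "5 * r powr s / r' powr s \<le> ?c * r\<^sup>2 * (8 * (1 / d\<^sup>2))"
      unfolding d2 using c by (simp add: mult_left_mono)
    then show ?thesis by (simp add: mult_ac)
  qed
  obtain g where g: "g \<in> G" "suminf (load_term x \<rho> ?c s g r') < 1"
    by (rule light_child_exists[of ?c s r r' \<rho> x y G d])
      (use c s r r' \<rho> summ light G d \<open>8 * r' \<le> d\<close> sep many small in auto)
  obtain p q where pq: "p \<in> gauss_ints" "q \<in> gauss_ints" "q \<noteq> 0" "cmod q \<le> 2 * real n" "g = p / q"
    using frac[OF g(1)] by blast
  have "\<psi> t \<le> \<psi> (cmod q)"
    using pq n t4 by (intro monotone_onD[OF mono]) auto
  then have "r' \<le> \<psi> (cmod q)" using \<psi>t by (simp add: r'_def)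
  moreover have "dist y g \<le> r / 2" using G g by auto
  ultimately show thesis using that[of r' g p q] r' g pq by blast
qed

text \<open>By \<open>less\<close> the initial disc has load below 1, and iterating
  \<open>light_step\<close> yields nested discs shrinking to a point. Each later disc shows a close
  admissible fraction, and the loads keep the point out of every given ball.\<close>

lemma approximable_set_not_covered:
  fixes x :: "nat \<Rightarrow> complex"
  assumes pos: "\<And>x. 0 < x \<Longrightarrow> 0 < \<psi> x" and mono: "antimono_on {0<..} \<psi>"
    and s: "0 < s" "s \<le> 2" and b: "2 < b" "b * s < 4"
    and freq: "\<And>X. \<exists>t\<ge>X. t powr - b < \<psi> t"
    and \<rho>: "\<And>i. 0 < \<rho> i" and summ: "summable (\<lambda>i. \<rho> i powr s)"
    and less: "(\<Sum>i. \<rho> i powr s) < light_const * (1 / 8) powr s"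
  shows "\<not> approximable_set \<psi> \<subseteq> (\<Union>i. cball (x i) (\<rho> i))"
proof -
  let ?L = "\<lambda>y r. suminf (load_term x \<rho> light_const s y r)"
  have c: "0 < light_const" "light_const \<le> 1" by (simp_all add: light_const_def)
  have sl: "summable (load_term x \<rho> light_const s y r)" if "0 < r" for y r
    using that c s \<rho> summ by (intro summable_load_term) auto
  \<comment> \<open>\<open>P\<close> is the invariant of a disc at stage \<open>n\<close>,
    \<open>Q\<close> the relation to its successor. Fixing stage 0 places the limit in the punctured
    square.\<close>
  define P where "P = (\<lambda>(n::nat) (a :: complex \<times> real). 0 < snd a \<and> snd a \<le> (1 / 2) ^ n \<and> ?L (fst a) (snd a) < 1
      \<and> (n = 0 \<longrightarrow> a = (1 / 4, 1 / 8)))"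
  define Q where "Q = (\<lambda>(n::nat) (a :: complex \<times> real) a'. snd a' \<le> snd a / 2 \<and> dist (fst a) (fst a') \<le> snd a / 2 \<and>
      (\<exists>p\<in>gauss_ints. \<exists>q\<in>gauss_ints. q \<noteq> 0 \<and> fst a' = p / q \<and> snd a' \<le> \<psi> (cmod q)))"
  have "\<exists>f. \<forall>n. P n (f n) \<and> Q n (f n) (f (Suc n))"
  proof (rule dependent_nat_choice)
    have "?L (1 / 4) (1 / 8) \<le> (\<Sum>i. \<rho> i powr s / (light_const * (1 / 8) powr s))"
      using c s \<rho> summ by (intro suminf_le load_term_le sl summable_divide) auto
    also have "\<dots> = (\<Sum>i. \<rho> i powr s) / (light_const * (1 / 8) powr s)"
      using summ by (rule suminf_divide)
    also have "\<dots> < 1" using less c by simp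
    finally have "P 0 (1 / 4, 1 / 8)" by (simp add: P_def)
    then show "\<exists>a. P 0 a" by blast
  next
    fix a n assume P: "P n a"
    have "(1 / 2) ^ n \<le> (1::real)" by (simp add: power_le_one)
    with P have a: "0 < snd a" "snd a \<le> 1" "?L (fst a) (snd a) < 1" by (auto simp: P_def)
    obtain y' r' p q where *: "0 < r'" "r' \<le> snd a / 2" "dist (fst a) y' \<le> snd a / 2" "?L y' r' < 1"
      "p \<in> gauss_ints" "q \<in> gauss_ints" "q \<noteq> 0" "y' = p / q" "r' \<le> \<psi> (cmod q)"
      by (rule light_step[OF mono s b freq \<rho> summ a])
    have "r' \<le> (1 / 2) ^ Suc n" using *(2) P by (simp add: P_def)
    then have "P (Suc n) (y', r')" using * by (simp add: P_def)
    moreover have "Q n a (y', r')" unfolding Q_def using * by auto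
    ultimately show "\<exists>a'. P (Suc n) a' \<and> Q n a a'" by blast
  qed
  then obtain f where f: "\<And>n. P n (f n)" "\<And>n. Q n (f n) (f (Suc n))" by blast
  define S where "S = (\<lambda>n. cball (fst (f n)) (snd (f n)))"
  have small: "\<exists>n. snd (f n) < e" if e: "0 < e" for e
  proof -
    obtain n where "(1 / 2) ^ n < e" using real_arch_pow_inv[OF e, of "1 / 2"] by auto
    then have "snd (f n) < e" using f(1)[of n] by (auto simp: P_def)
    then show ?thesis by blast
  qed
  have dec: "S n \<subseteq> S m" if "m \<le> n" for m n
    using that
  proof (rule lift_Suc_antimono_le[rotated])
    show "S (Suc n) \<subseteq> S n" for n
    proof
      fix z assume "z \<in> S (Suc n)"
      then show "z \<in> S n"
        using f(2)[of n] dist_triangle[of "fst (f n)" z "fst (f (Suc n))"] by (auto simp: S_def Q_def)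
    qed
  qed
  obtain z where z: "\<And>n. z \<in> S n"
  proof (rule decreasing_closed_nest[of S])
    show "closed (S n)" for n by (simp add: S_def)
    show "S n \<noteq> {}" for n using f(1)[of n] by (simp add: S_def P_def)
    show "\<exists>n. \<forall>u\<in>S n. \<forall>v\<in>S n. dist u v < e" if e: "0 < e" for e
    proof -
      obtain n where n: "snd (f n) < e / 2" using small[of "e / 2"] e by auto
      have "dist u v < e" if "u \<in> S n" "v \<in> S n" for u v
        using that n dist_triangle3[of u v "fst (f n)"] by (auto simp: S_def)
      then show ?thesis by blast
    qed
  qed (use dec in auto)
  have "z \<in> approximable_set \<psi>"
  proof (rule approximable_setI[OF _ pos])
    have "f 0 = (1 / 4, 1 / 8)" using f(1)[of 0] by (simp add: P_def)
    then show "z \<in> unit_square - {0}"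
      using z[of 0] cball_subset_punctured_square by (auto simp: S_def)
    fix e :: real assume "0 < e"
    then obtain n where n: "snd (f n) < e" using small by blast
    obtain p q where pq: "p \<in> gauss_ints" "q \<in> gauss_ints" "q \<noteq> 0" "fst (f (Suc n)) = p / q" "snd (f (Suc n)) \<le> \<psi> (cmod q)"
      and half: "snd (f (Suc n)) \<le> snd (f n) / 2" using f(2)[of n] unfolding Q_def by blast
    have "cmod (z - p / q) \<le> snd (f (Suc n))"
      using z[of "Suc n"] pq by (simp add: S_def dist_norm norm_minus_commute)
    moreover have "snd (f (Suc n)) < e" using half n f(1)[of n] by (auto simp: P_def)
    ultimately show "\<exists>p\<in>gauss_ints. \<exists>q\<in>gauss_ints. q \<noteq> 0 \<and> cmod (z - p / q) \<le> \<psi> (cmod q) \<and> cmod (z - p / q) < e"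
      using pq by (intro bexI[of _ p] bexI[of _ q]) auto
  qed
  moreover have "z \<notin> cball (x i) (\<rho> i)" for i
  proof
    assume zi: "z \<in> cball (x i) (\<rho> i)"
    \<comment> \<open>Once the disc is smaller than the ball containing \<open>z\<close>, that ball
      alone contributes 1 to the load.\<close>
    obtain n where n: "snd (f n) < \<rho> i" using small \<rho> by blast
    have "dist (fst (f n)) (x i) \<le> snd (f n) + \<rho> i"
      using zi z[of n] dist_triangle2[of "fst (f n)" "x i" z] by (simp add: S_def dist_commute)
    then have "load_term x \<rho> light_const s (fst (f n)) (snd (f n)) i = 1"
      using n by (simp add: load_term_def)
    then have "1 \<le> ?L (fst (f n)) (snd (f n))"
      using sum_le_suminf[OF sl, of "snd (f n)" "{i}" "fst (f n)"] load_term_nonneg c f(1)[of n]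
      by (auto simp: P_def)
    then show False using f(1)[of n] by (auto simp: P_def)
  qed
  ultimately show ?thesis by blast
qed

text \<open>A null set has a cheap cover by sets of diameter at most 1, for which passing from
  \<open>u\<close> to the larger exponent \<open>s\<close> does not raise the cost. The positive
  \<open>s\<close> also handles \<open>u = 0\<close>. Enlarging the sets to balls then contradicts
  \<open>approximable_set_not_covered\<close>.\<close>

lemma hausdorff_measure_approximable_neq_0:
  assumes pos: "\<And>x. 0 < x \<Longrightarrow> 0 < \<psi> x" and mono: "antimono_on {0<..} \<psi>"
    and s: "0 < s" "s \<le> 2" and b: "2 < b" "b * s < 4"
    and freq: "\<And>X. \<exists>t\<ge>X. t powr - b < \<psi> t"
    and u: "0 \<le> u" "u \<le> s"
  shows "hausdorff_measure u (approximable_set \<psi>) \<noteq> 0"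
proof
  let ?W = "approximable_set \<psi>"
  assume "hausdorff_measure u ?W = 0"
  moreover have "hausdorff_premeasure u 1 ?W \<le> hausdorff_measure u ?W"
    unfolding hausdorff_measure_def by (rule SUP_upper) simp
  ultimately have pre: "hausdorff_premeasure u 1 ?W = 0" by simp
  \<comment> \<open>Half of the allowed total is for the diameters, half for the
    enlargement.\<close>
  define \<eta> where "\<eta> = light_const * (1 / 8) powr s / 2"
  have "0 < \<eta>" by (simp add: \<eta>_def light_const_def)
  have "hausdorff_premeasure u 1 ?W < ennreal \<eta>" using pre \<open>0 < \<eta>\<close> by simp
  then obtain U where U: "?W \<subseteq> (\<Union>i. U i)" "\<And>i. bounded (U i)" "\<And>i. diameter (U i) \<le> 1"
    and sumU: "(\<Sum>i. diam_pow u (U i)) < ennreal \<eta>"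
    unfolding hausdorff_premeasure_def INF_less_iff by blast
  define a where "a = (\<lambda>i. diameter (U i) powr s)"
  have "ennreal (a i) \<le> diam_pow u (U i)" for i
  \<comment> \<open>The cases in which \<open>diam_pow\<close> follows a convention rather than
    \<open>powr\<close>.\<close>
  proof (cases "U i = {} \<or> u = 0")
    case True
    then show ?thesis
      using s U(3)[of i] diameter_ge_0[OF U(2)[of i]] by (auto simp: a_def diam_pow_def intro!: powr_le1)
  next
    case False
    then show ?thesis
      using u U(3)[of i] diameter_ge_0[OF U(2)[of i]] by (auto simp: a_def diam_pow_def intro!: ennreal_leI powr_mono')
  qed
  then have "(\<Sum>i. ennreal (a i)) \<le> (\<Sum>i. diam_pow u (U i))"
    by (intro suminf_le) auto
  also note sumU
  finally have less: "(\<Sum>i. ennreal (a i)) < ennreal \<eta>" .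
  have a0: "0 \<le> a i" for i by (simp add: a_def)
  have summ_a: "summable a"
    using less a0 by (intro summable_suminf_not_top) auto
  have suma: "suminf a < \<eta>"
    using less a0 summ_a suminf_nonneg[of a] by (simp add: suminf_ennreal2 ennreal_less_iff)
  \<comment> \<open>Sets of diameter 0 have to be enlarged, since the balls of the covering must have positive radius.\<close>
  define e where "e = (\<lambda>i. \<eta> * (1 / 2) ^ Suc i)"
  have e0: "0 < e i" for i using \<open>0 < \<eta>\<close> by (simp add: e_def)
  have "e sums (\<eta> * 1)" unfolding e_def by (intro sums_mult power_half_series)
  then have e: "summable e" "suminf e = \<eta>" by (auto simp: sums_iff)
  define \<rho> where "\<rho> = (\<lambda>i. max (diameter (U i)) (e i powr (1 / s)))"
  have \<rho>0: "0 < \<rho> i" for i using e0[of i] by (simp add: \<rho>_def less_max_iff_disj)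
  have \<rho>s: "\<rho> i powr s \<le> a i + e i" for i
    using e0[of i] a0[of i] s by (auto simp: \<rho>_def max_def a_def powr_powr)
  have summ: "summable (\<lambda>i. \<rho> i powr s)"
    by (rule summable_comparison_test'[OF summable_add[OF summ_a e(1)]]) (simp add: \<rho>s)
  have "(\<Sum>i. \<rho> i powr s) \<le> (\<Sum>i. a i + e i)"
    by (intro suminf_le \<rho>s summ summable_add summ_a e)
  also have "\<dots> = suminf a + \<eta>" using suminf_add[OF summ_a e(1)] e(2) by simp
  also have "\<dots> < light_const * (1 / 8) powr s" using suma by (simp add: \<eta>_def)
  finally have sum\<rho>: "(\<Sum>i. \<rho> i powr s) < light_const * (1 / 8) powr s" .
  \<comment> \<open>Any point of \<open>U i\<close> serves as centre; for empty \<open>U i\<close>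
    the choice is arbitrary and harmless.\<close>
  define x where "x = (\<lambda>i. SOME y. y \<in> U i)"
  have Ux: "U i \<subseteq> cball (x i) (\<rho> i)" for i
  proof
    fix y assume y: "y \<in> U i"
    then have "x i \<in> U i" unfolding x_def by (rule someI)
    then have "dist (x i) y \<le> diameter (U i)" using y U(2) by (intro diameter_bounded_bound)
    then show "y \<in> cball (x i) (\<rho> i)" by (simp add: \<rho>_def)
  qed
  have "(\<Union>i. U i) \<subseteq> (\<Union>i. cball (x i) (\<rho> i))" by (intro UN_mono Ux) simp
  with U(1) have "?W \<subseteq> (\<Union>i. cball (x i) (\<rho> i))" by (rule order_trans)
  moreover have "\<not> ?W \<subseteq> (\<Union>i. cball (x i) (\<rho> i))"
    by (rule approximable_set_not_covered[OF pos mono s b freq \<rho>0 summ sum\<rho>])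
  ultimately show False by contradiction
qed

subsection \<open>Packing measure\<close>

text \<open>Disjoint balls of radius at most 1 centred in the square lie in a disc of radius 2, so
  the squared diameters sum to at most 16. The remaining factor
  \<open>(2 * \<delta>) powr (s - 2)\<close> tends to 0.\<close>

lemma packing_measure_unit_square_eq_0:
  assumes s: "2 < s" and E: "E \<subseteq> unit_square"
  shows "packing_measure s E = 0"
proof -
  have bound: "(\<Sum>\<^sub>\<infinity>(x, r)\<in>C. ennreal ((2 * r) powr s)) \<le> ennreal ((2 * \<delta>) powr (s - 2) * 16)"
    if \<delta>: "0 < \<delta>" "\<delta> \<le> 1" and C: "is_packing \<delta> E C" for \<delta> C
  proof -
    have C': "x \<in> E \<and> 0 < r \<and> r \<le> \<delta>" if "(x, r) \<in> C" for x r
      using C that by (auto simp: is_packing_def)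
    have fin: "(\<Sum>(x, r)\<in>F. ennreal ((2 * r) powr s)) \<le> ennreal ((2 * \<delta>) powr (s - 2) * 16)"
      if F: "finite F" "F \<subseteq> C" for F
    proof -
      have "(\<Sum>i\<in>F. (snd i)\<^sup>2) \<le> 2\<^sup>2"
      proof (rule sum_radii_squared_le_of_disjoint[where c = fst and w = 0])
        show "disjoint_family_on (\<lambda>i. ball (fst i) (snd i)) F"
          unfolding disjoint_family_on_def
        proof (intro ballI impI)
          fix i j assume "i \<in> F" "j \<in> F" "i \<noteq> j"
          then have "cball (fst i) (snd i) \<inter> cball (fst j) (snd j) = {}"
            using C F(2) by (auto simp: is_packing_def disjoint_family_on_def split_beta subset_eq)
          then show "ball (fst i) (snd i) \<inter> ball (fst j) (snd j) = {}"
            using ball_subset_cball by blast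
        qed
        show "ball (fst i) (snd i) \<subseteq> cball 0 2" if "i \<in> F" for i
        proof
          fix z assume z: "z \<in> ball (fst i) (snd i)"
          have "fst i \<in> E \<and> snd i \<le> 1" using C'[of "fst i" "snd i"] that F \<delta> by auto
          then show "z \<in> cball 0 2"
            using z dist_triangle[of 0 z "fst i"] unit_square_norm_le[of "fst i"] E by (auto simp: dist_norm)
        qed
      qed (use F C' in \<open>force+\<close>)
      then have sq: "(\<Sum>i\<in>F. 4 * (snd i)\<^sup>2) \<le> 16" by (simp add: sum_distrib_left[symmetric])
      have "(\<Sum>(x, r)\<in>F. ennreal ((2 * r) powr s)) = (\<Sum>i\<in>F. ennreal ((2 * snd i) powr s))"
        by (simp add: split_beta)
      also have "\<dots> = ennreal (\<Sum>i\<in>F. (2 * snd i) powr s)" by (rule sum_ennreal) simp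
      also have "(\<Sum>i\<in>F. (2 * snd i) powr s) \<le> (\<Sum>i\<in>F. (2 * \<delta>) powr (s - 2) * (4 * (snd i)\<^sup>2))"
      proof (rule sum_mono)
        fix i assume "i \<in> F"
        then have r: "0 < snd i" "snd i \<le> \<delta>" using C'[of "fst i" "snd i"] F by auto
        have "(2 * snd i) powr s = (2 * snd i) powr (s - 2) * (2 * snd i) powr 2"
          by (simp add: powr_add[symmetric])
        also have "(2 * snd i) powr 2 = 4 * (snd i)\<^sup>2"
          using r by (simp add: powr_numeral power_mult_distrib)
        also have "(2 * snd i) powr (s - 2) * (4 * (snd i)\<^sup>2) \<le> (2 * \<delta>) powr (s - 2) * (4 * (snd i)\<^sup>2)"
          using r s by (intro mult_right_mono powr_mono2) auto
        finally show "(2 * snd i) powr s \<le> (2 * \<delta>) powr (s - 2) * (4 * (snd i)\<^sup>2)" .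
      qed
      also have "\<dots> \<le> (2 * \<delta>) powr (s - 2) * 16"
        unfolding sum_distrib_left[of _ "\<lambda>i. 4 * (snd i)\<^sup>2", symmetric] using sq by (intro mult_left_mono) auto
      finally show ?thesis by (simp add: ennreal_leI)
    qed
    show ?thesis
      by (subst nonneg_infsum_complete) (auto intro!: SUP_least fin)
  qed
  have le: "packing_premeasure s E \<le> ennreal e" if "0 < e" for e
  proof -
    have "((\<lambda>\<delta>. (2 * \<delta>) powr (s - 2) * 16) \<longlongrightarrow> (2 * 0) powr (s - 2) * 16) (at_right 0)"
      using s by (intro tendsto_intros) (auto intro!: eventually_at_rightI[of 0 1])
    then have "\<forall>\<^sub>F \<delta> in at_right 0. (2 * \<delta>) powr (s - 2) * 16 < e"
      using that by (intro order_tendstoD(2)) auto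
    moreover have "\<forall>\<^sub>F \<delta>::real in at_right 0. \<delta> \<le> 1 \<and> 0 < \<delta>"
      by (intro eventually_at_rightI[of 0 1]) auto
    ultimately have "\<forall>\<^sub>F \<delta> in at_right 0. (2 * \<delta>) powr (s - 2) * 16 < e \<and> \<delta> \<le> 1 \<and> 0 < \<delta>"
      by eventually_elim auto
    then obtain \<delta> where \<delta>: "(2 * \<delta>) powr (s - 2) * 16 < e" "\<delta> \<le> 1" "0 < \<delta>"
      using eventually_happens trivial_limit_at_right_real by blast
    have "packing_premeasure s E \<le> (SUP C \<in> {C. is_packing \<delta> E C}. \<Sum>\<^sub>\<infinity>(x, r) \<in> C. ennreal ((2 * r) powr s))"
      unfolding packing_premeasure_def using \<delta> by (intro INF_lower) simp
    also have "\<dots> \<le> ennreal ((2 * \<delta>) powr (s - 2) * 16)"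
      using \<delta> bound by (intro SUP_least) auto
    also have "\<dots> \<le> ennreal e" using \<delta> by (intro ennreal_leI) simp
    finally show ?thesis .
  qed
  have pE: "packing_premeasure s E \<le> 0"
    by (rule ennreal_le_epsilon) (simp add: le)
  have "packing_premeasure s ({} :: complex set) \<le> (SUP C \<in> {C. is_packing 1 ({} :: complex set) C}. \<Sum>\<^sub>\<infinity>(x, r) \<in> C. ennreal ((2 * r) powr s))"
    unfolding packing_premeasure_def by (intro INF_lower) simp
  also have "\<dots> \<le> 0"
  proof (rule SUP_least)
    fix C :: "(complex \<times> real) set" assume "C \<in> {C. is_packing 1 {} C}"
    then have "C = {}" by (auto simp: is_packing_def)
    then show "(\<Sum>\<^sub>\<infinity>(x, r)\<in>C. ennreal ((2 * r) powr s)) \<le> 0" by simp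
  qed
  finally have p0: "packing_premeasure s ({} :: complex set) \<le> 0" .
  \<comment> \<open>The cover by \<open>E\<close> alone, padded with empty sets of premeasure
    0.\<close>
  define F where "F = (\<lambda>i::nat. if i = 0 then E else {})"
  have "packing_measure s E \<le> (\<Sum>i. packing_premeasure s (F i))"
    unfolding packing_measure_def by (intro INF_lower) (auto simp: F_def)
  also have "\<dots> = (\<Sum>i. 0)"
    using pE p0 by (intro arg_cong[where f = suminf]) (auto simp: F_def fun_eq_iff)
  finally show ?thesis by simp
qed

text \<open>Separated fractions in a disc inside the closure can be moved slightly into
  \<open>F\<close>. About \<open>n^4\<close> balls of radius comparable to \<open>n^-2\<close> have
  total of order \<open>n powr (4 - 2 * s)\<close>, which is unbounded.\<close>

lemma packing_premeasure_somewhere_dense: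
  assumes s: "0 \<le> s" "s < 2" and dense: "interior (closure F) \<noteq> {}"
  shows "packing_premeasure s (F :: complex set) = \<infinity>"
proof -
  obtain a R where R: "0 < R" "R \<le> 1" "cball a R \<subseteq> closure F"
  proof -
    obtain a where "a \<in> interior (closure F)" using dense by blast
    then obtain e where "0 < e" "cball a e \<subseteq> closure F" by (auto simp: mem_interior_cball)
    then show thesis by (intro that[of "min 1 e" a]) (auto simp: subset_iff)
  qed
  define \<rho> where "\<rho> = R / 2"
  \<comment> \<open>Chosen so that the packing below has total at least
    \<open>c * n powr (4 - 2 * s)\<close>.\<close>
  define c where "c = \<rho>\<^sup>2 / 80000 * (1 / 8) powr s"
  have \<rho>: "0 < \<rho>" "\<rho> \<le> 1" using R by (auto simp: \<rho>_def)
  have "0 < c" using \<rho> by (simp add: c_def)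
  have "ennreal K \<le> packing_premeasure s F" if "0 < K" for K
    unfolding packing_premeasure_def
  proof (rule INF_greatest)
    fix \<delta> :: real assume "\<delta> \<in> {0<..}"
    then have "0 < \<delta>" by simp
    \<comment> \<open>The three summands give the count of fractions,
      \<open>h \<le> \<delta>\<close>, and a total of at least \<open>K\<close>.\<close>
    obtain n :: nat where n: "100 / \<rho>\<^sup>2 + 1 / \<delta> + (K / c) powr (1 / (4 - 2 * s)) \<le> real n" using real_arch_simple by blast
    have "0 < 100 / \<rho>\<^sup>2" "0 < 1 / \<delta>" "0 \<le> (K / c) powr (1 / (4 - 2 * s))" using \<rho> \<open>0 < \<delta>\<close> by auto
    then have n': "100 / \<rho>\<^sup>2 \<le> real n" "1 / \<delta> \<le> real n" "0 < real n"
        "(K / c) powr (1 / (4 - 2 * s)) \<le> real n" using n by linarith+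
    define h where "h = 1 / (4 * (real n)\<^sup>2)"
    have "1 \<le> real n" using n'(3) by simp
    have "0 < h" using n' by (simp add: h_def)
    have "h \<le> \<delta>"
    proof -
      have "1 \<le> \<delta> * real n" using n'(2) \<open>0 < \<delta>\<close> by (simp add: field_simps)
      also have "\<dots> \<le> \<delta> * (4 * (real n)\<^sup>2)"
        using \<open>0 < \<delta>\<close> self_le_power[OF \<open>1 \<le> real n\<close>, of 2] by (intro mult_left_mono) linarith+
      finally show ?thesis using n' by (simp add: h_def field_simps)
    qed
    obtain G where G: "finite G" "G \<subseteq> cball a (2 * \<rho>)" "\<rho>\<^sup>2 * real n ^ 4 / 80000 \<le> real (card G)"
      and sep: "\<And>g k. g \<in> G \<Longrightarrow> k \<in> G \<Longrightarrow> g \<noteq> k \<Longrightarrow> h \<le> dist g k"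
      using many_separated_fractions[of \<rho> n a] \<rho> n' unfolding h_def by metis
    \<comment> \<open>Moving each centre by less than \<open>h / 8\<close> leaves gaps above
      \<open>h / 2\<close>, so closed balls of radius \<open>h / 4\<close> stay disjoint.\<close>
    have "\<exists>y\<in>F. dist y g < h / 8" if "g \<in> G" for g
    proof -
      have "g \<in> closure F" using G(2) R(3) that by (auto simp: \<rho>_def)
      moreover have "0 < h / 8" using \<open>0 < h\<close> by simp
      ultimately show ?thesis unfolding closure_approachable by blast
    qed
    then obtain y where y: "\<And>g. g \<in> G \<Longrightarrow> y g \<in> F" "\<And>g. g \<in> G \<Longrightarrow> dist (y g) g < h / 8" by metis
    have ysep: "h / 2 < dist (y g) (y k)" if "g \<in> G" "k \<in> G" "g \<noteq> k" for g k
    proof -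
      have "h \<le> dist g k" using sep that by blast
      also have "\<dots> \<le> dist g (y g) + dist (y g) (y k) + dist (y k) k"
        using dist_triangle[of g k "y g"] dist_triangle[of "y g" k "y k"] by linarith
      finally show ?thesis using y(2)[of g] y(2)[of k] that \<open>0 < h\<close> by (simp add: dist_commute)
    qed
    have inj: "inj_on (\<lambda>g. (y g, h / 4)) G"
    proof (rule inj_onI, rule ccontr)
      fix g k assume "g \<in> G" "k \<in> G" "(y g, h / 4) = (y k, h / 4)" "g \<noteq> k"
      then show False using ysep[of g k] \<open>0 < h\<close> by simp
    qed
    define C where "C = (\<lambda>g. (y g, h / 4)) ` G"
    have "disjoint_family_on (\<lambda>(x, r). cball x r) C"
      unfolding disjoint_family_on_def
    proof (intro ballI impI)
      fix i j assume ij: "i \<in> C" "j \<in> C" "i \<noteq> j"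
      then obtain g k where gk: "g \<in> G" "k \<in> G" "i = (y g, h / 4)" "j = (y k, h / 4)" "g \<noteq> k"
        by (auto simp: C_def)
      have False if "v \<in> cball (y g) (h / 4)" "v \<in> cball (y k) (h / 4)" for v
        using that ysep[OF gk(1,2,5)] dist_triangle2[of "y g" "y k" v] by (simp add: dist_commute)
      then show "(case i of (x, r) \<Rightarrow> cball x r) \<inter> (case j of (x, r) \<Rightarrow> cball x r) = {}"
        using gk by auto
    qed
    then have pack: "is_packing \<delta> F C"
      using G(1) y(1) \<open>0 < h\<close> \<open>h \<le> \<delta>\<close> by (auto simp: is_packing_def C_def countable_finite)
    have "K \<le> card G * (h / 2) powr s"
    proof -
      have "K / c = ((K / c) powr (1 / (4 - 2 * s))) powr (4 - 2 * s)"
        using s \<open>0 < K\<close> \<open>0 < c\<close> by (simp add: powr_powr)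
      also have "\<dots> \<le> real n powr (4 - 2 * s)"
        using s n'(4) by (intro powr_mono2) auto
      finally have "K \<le> c * real n powr (4 - 2 * s)" using \<open>0 < c\<close> by (simp add: field_simps)
      also have "\<dots> = (\<rho>\<^sup>2 * real n ^ 4 / 80000) * (h / 2) powr s"
      proof -
        have "(h / 2) powr s = (1 / 8 * (1 / (real n)\<^sup>2)) powr s" by (simp add: h_def)
        also have "\<dots> = (1 / 8) powr s * (1 / (real n)\<^sup>2) powr s" by (rule powr_mult)
        also have "(1 / (real n)\<^sup>2) powr s = real n powr (- 2 * s)"
          using n' by (simp add: powr_powr[symmetric] powr_minus_divide powr_numeral powr_divide)
        finally show ?thesis
          using n' by (simp add: c_def powr_diff powr_minus_divide powr_numeral)
      qed
      also have "\<dots> \<le> card G * (h / 2) powr s" using G(3) by (intro mult_right_mono) auto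
      finally show ?thesis .
    qed
    then have "ennreal K \<le> ennreal (card G * (h / 2) powr s)" by (rule ennreal_leI)
    also have "\<dots> = (\<Sum>\<^sub>\<infinity>(x, r)\<in>C. ennreal ((2 * r) powr s))"
      using G(1) by (simp add: C_def sum.reindex[OF inj] ennreal_mult ennreal_of_nat_eq_real_of_nat)
    also have "\<dots> \<le> (SUP C \<in> {C. is_packing \<delta> F C}. \<Sum>\<^sub>\<infinity>(x, r)\<in>C. ennreal ((2 * r) powr s))"
      using pack by (intro SUP_upper) simp
    finally show "ennreal K \<le> (SUP C \<in> {C. is_packing \<delta> F C}. \<Sum>\<^sub>\<infinity>(x, r)\<in>C. ennreal ((2 * r) powr s))" .
  qed
  then have "ennreal (real (Suc k)) \<le> packing_premeasure s F" for k by (simp del: of_nat_Suc)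
  then have "\<not> packing_premeasure s F < of_nat (Suc k)" for k
    by (simp add: ennreal_of_nat_eq_real_of_nat not_less del: of_nat_Suc)
  show ?thesis
  proof (rule ccontr)
    assume "packing_premeasure s F \<noteq> \<infinity>"
    then obtain k where "packing_premeasure s F < of_nat k"
      using ennreal_Ex_less_of_nat[of "packing_premeasure s F"] by (auto simp: less_top)
    also have "\<dots> \<le> of_nat (Suc k)" by (rule of_nat_mono) simp
    finally show False using \<open>\<And>k. \<not> packing_premeasure s F < of_nat (Suc k)\<close> by blast
  qed
qed

text \<open>Measure 0 would give a countable cover by sets of finite premeasure, all nowhere dense.
  A generic point near \<open>1 / 4\<close> is approximable but lies in none of their
  closures.\<close>

lemma packing_measure_approximable_neq_0:
  assumes pos: "\<And>x. 0 < x \<Longrightarrow> 0 < \<psi> x" and s: "0 \<le> s" "s < 2"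
  shows "packing_measure s (approximable_set \<psi>) \<noteq> 0"
proof
  let ?W = "approximable_set \<psi>"
  define rat where "rat = {(p, q). p \<in> gauss_ints \<and> q \<in> gauss_ints \<and> q \<noteq> (0::complex)}"
  \<comment> \<open>The radius \<open>1 / Suc N\<close> makes the fractions arbitrarily close, as
    \<open>approximable_setI\<close> requires.\<close>
  define D where "D = (\<lambda>N::nat. \<Union>(p, q)\<in>rat. ball (p / q) (min (\<psi> (cmod q)) (1 / Suc N)))"
  have "open (D N)" for N by (auto simp: D_def)
  have D_dense: "z \<in> closure (D N)" for N z
  proof -
    have "\<exists>y\<in>D N. dist y z < e" if "0 < e" for e
    proof -
      define \<rho> where "\<rho> = min 1 (e / 4)"
      have \<rho>: "0 < \<rho>" "\<rho> \<le> 1" "2 * \<rho> < e" using that by (auto simp: \<rho>_def min_def)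
      obtain n :: nat where n: "100 / \<rho>\<^sup>2 \<le> real n" using real_arch_simple by blast
      \<comment> \<open>Only the existence of one fraction near \<open>z\<close> is drawn from the
        count.\<close>
      obtain G where G: "G \<subseteq> cball z (2 * \<rho>)" "\<rho>\<^sup>2 * real n ^ 4 / 80000 \<le> real (card G)"
        and frac: "\<And>g. g \<in> G \<Longrightarrow> \<exists>p\<in>gauss_ints. \<exists>q\<in>gauss_ints. q \<noteq> 0 \<and> cmod q \<le> 2 * real n \<and> g = p / q"
        using many_separated_fractions[OF \<rho>(1,2) n, of z] by metis
      have "0 < 100 / \<rho>\<^sup>2" using \<rho> by simp
      then have "0 < real n" using n by linarith
      then have "0 < \<rho>\<^sup>2 * real n ^ 4 / 80000" using \<rho> by simp
      then have "G \<noteq> {}" using G(2) by auto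
      then obtain g where "g \<in> G" by blast
      then obtain p q where pq: "p \<in> gauss_ints" "q \<in> gauss_ints" "q \<noteq> 0" "g = p / q" using frac by blast
      have "g \<in> D N" unfolding D_def
      proof (rule UN_I)
        show "(p, q) \<in> rat" using pq by (simp add: rat_def)
        show "g \<in> (case (p, q) of (p, q) \<Rightarrow> ball (p / q) (min (\<psi> (cmod q)) (1 / Suc N)))"
          using pq pos[of "cmod q"] by simp
      qed
      moreover have "dist g z < e" using G(1) \<open>g \<in> G\<close> \<rho>(3) by (auto simp: dist_commute)
      ultimately show ?thesis by blast
    qed
    then show ?thesis by (auto simp: closure_approachable)
  qed
  assume "packing_measure s ?W = 0"
  then have "packing_measure s ?W < 1" by simp
  then obtain F where F: "?W \<subseteq> (\<Union>i. F i)" and less: "(\<Sum>i. packing_premeasure s (F i)) < 1"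
    unfolding packing_measure_def INF_less_iff by blast
  have nowhere: "interior (closure (F i)) = {}" for i
  proof (rule ccontr)
    assume "interior (closure (F i)) \<noteq> {}"
    then have "packing_premeasure s (F i) = \<infinity>" by (rule packing_premeasure_somewhere_dense[OF s])
    moreover have "packing_premeasure s (F i) \<le> (\<Sum>i. packing_premeasure s (F i))"
      using sum_le_suminf[of "\<lambda>i. packing_premeasure s (F i)" "{i}"] by simp
    ultimately show False using less by (simp add: top_unique)
  qed
  define \<G> where "\<G> = range D \<union> range (\<lambda>i. - closure (F i))"
  have "UNIV \<subseteq> closure (\<Inter>\<G>)"
  proof (rule Baire)
    fix T assume "T \<in> \<G>"
    then show "openin (top_of_set UNIV) T \<and> UNIV \<subseteq> closure T"
      using \<open>\<And>N. open (D N)\<close> D_dense nowhere by (auto simp: \<G>_def closure_complement)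
  qed (auto simp: \<G>_def)
  then have "1 / 4 \<in> closure (\<Inter>\<G>)" by blast
  then obtain z where z: "z \<in> \<Inter>\<G>" "dist z (1 / 4) < 1 / 8"
    unfolding closure_approachable by (meson zero_less_divide_1_iff zero_less_numeral)
  have "z \<in> ?W"
  proof (rule approximable_setI[OF _ pos])
    show "z \<in> unit_square - {0}"
    proof -
      have "z \<in> cball (1 / 4) (1 / 8)" using z(2) by (simp add: dist_commute)
      then show ?thesis using cball_subset_punctured_square by blast
    qed
    fix e :: real assume "0 < e"
    then obtain N where N: "1 / real (Suc N) < e"
      using reals_Archimedean by (auto simp: inverse_eq_divide)
    have "z \<in> D N" using z(1) by (auto simp: \<G>_def)
    then obtain p q where "(p, q) \<in> rat" "dist (p / q) z < min (\<psi> (cmod q)) (1 / Suc N)"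
      by (auto simp: D_def)
    then show "\<exists>p\<in>gauss_ints. \<exists>q\<in>gauss_ints. q \<noteq> 0 \<and> cmod (z - p / q) \<le> \<psi> (cmod q) \<and> cmod (z - p / q) < e"
      using N by (intro bexI[of _ p] bexI[of _ q]) (auto simp: rat_def dist_norm norm_minus_commute)
  qed
  then obtain i where "z \<in> F i" using F by blast
  moreover have "z \<notin> closure (F i)" using z(1) by (auto simp: \<G>_def)
  ultimately show False using closure_subset by blast
qed

subsection \<open>The dimension formulas\<close>

text \<open>Otherwise the quotient would eventually be at least \<open>b\<close>, and so would its
  lower limit.\<close>

lemma lower_order_less_imp_frequently:
  assumes pos: "\<And>x. 0 < x \<Longrightarrow> 0 < \<psi> x" and less: "lower_order \<psi> < ereal b"
  shows "\<exists>t\<ge>X. t powr - b < \<psi> t"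
proof (rule ccontr)
  assume neg: "\<not> ?thesis"
  have "\<forall>\<^sub>F x in at_top. ereal b \<le> ereal (- ln (\<psi> x) / ln x)"
    using eventually_ge_at_top[of "max X 2"]
  proof eventually_elim
    case (elim x)
    then have x: "0 < ln x" "0 < x" by auto
    have "\<psi> x \<le> x powr - b" using neg elim by force
    then have "ln (\<psi> x) \<le> ln (x powr - b)" using pos x by (subst ln_le_cancel_iff) auto
    then have "b * ln x \<le> - ln (\<psi> x)" using x by (simp add: ln_powr)
    then show ?case using x by (simp add: field_simps)
  qed
  then have "ereal b \<le> lower_order \<psi>" unfolding lower_order_def by (rule Liminf_bounded)
  with less show False by simp
qed

lemma less_lower_order_imp_eventually:
  assumes pos: "\<And>x. 0 < x \<Longrightarrow> 0 < \<psi> x" and less: "ereal b < lower_order \<psi>"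
  shows "\<exists>X. \<forall>x\<ge>X. \<psi> x \<le> x powr - b"
proof -
  have "\<forall>\<^sub>F x in at_top. ereal b < ereal (- ln (\<psi> x) / ln x)"
    using less unfolding lower_order_def by (rule less_LiminfD)
  then have "\<forall>\<^sub>F x in at_top. \<psi> x \<le> x powr - b"
    using eventually_ge_at_top[of 2]
  proof eventually_elim
    case (elim x)
    then have x: "0 < ln x" "0 < x" by auto
    from elim have "b * ln x < - ln (\<psi> x)" using x by (simp add: field_simps)
    then have "ln (\<psi> x) \<le> ln (x powr - b)" using x by (simp add: ln_powr)
    then show ?case using pos x by (subst (asm) ln_le_cancel_iff) auto
  qed
  then show ?thesis by (simp add: eventually_at_top_linorder)
qed

lemma lower_order_nonneg:
  assumes pos: "\<And>x. 0 < x \<Longrightarrow> 0 < \<psi> x" and lim: "(\<psi> \<longlongrightarrow> 0) at_top"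
  shows "0 \<le> lower_order \<psi>"
proof -
  have "\<forall>\<^sub>F x in at_top. \<psi> x < 1" using lim by (rule order_tendstoD) simp
  then have "\<forall>\<^sub>F x in at_top. 0 \<le> ereal (- ln (\<psi> x) / ln x)"
    using eventually_ge_at_top[of 2]
  proof eventually_elim
    case (elim x)
    then have "ln (\<psi> x) \<le> 0" "0 < ln x" using pos[of x] by auto
    then show ?case by (simp add: divide_nonpos_pos)
  qed
  then show ?thesis unfolding lower_order_def by (rule Liminf_bounded)
qed

lemma approximable_set_subset_unit_square: "approximable_set \<psi> \<subseteq> unit_square"
  unfolding approximable_set_def by blast

text \<open>The conventions \<open>4 / 0 = \<infinity>\<close> and
  \<open>4 / \<infinity> = 0\<close> make the equivalences hold at both extreme orders as
  well.\<close>

lemma ereal_less_divide_iff: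
  fixes l :: ereal
  assumes "0 \<le> l" "0 < s"
  shows "ereal s < 4 / l \<longleftrightarrow> l < ereal (4 / s)" "4 / l < ereal s \<longleftrightarrow> ereal (4 / s) < l"
proof -
  consider "l = 0" | t where "l = ereal t" "0 < t" | "l = \<infinity>"
    using assms(1) by (cases l) force+
  then have "(ereal s < 4 / l \<longleftrightarrow> l < ereal (4 / s)) \<and> (4 / l < ereal s \<longleftrightarrow> ereal (4 / s) < l)"
  proof cases
    case 2
    then have "4 / l = ereal (4 / t)" by (metis ereal_divide less_irrefl numeral_eq_ereal)
    then show ?thesis using 2 assms(2) by (simp add: field_simps)
  qed (use assms(2) in \<open>auto simp: divide_ereal_def\<close>)
  then show "ereal s < 4 / l \<longleftrightarrow> l < ereal (4 / s)" "4 / l < ereal s \<longleftrightarrow> ereal (4 / s) < l" by auto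
qed

theorem theorem1p2:
  fixes \<psi> :: "real \<Rightarrow> real"
  assumes "\<And>x. 0 < x \<Longrightarrow> 0 < \<psi> x"
    and "antimono_on {0<..} \<psi>"
    and "(\<psi> \<longlongrightarrow> 0) at_top"
  shows "hausdorff_dim (approximable_set \<psi>) = min (4 / lower_order \<psi>) 2 \<and>
         packing_dim (approximable_set \<psi>) = 2"
proof
  let ?W = "approximable_set \<psi>" and ?l = "lower_order \<psi>"
  note pos = assms(1) and mono = assms(2)
  have l0: "0 \<le> ?l" using lower_order_nonneg[OF pos assms(3)] .
  show "hausdorff_dim ?W = min (4 / ?l) 2"
  proof (rule antisym)
    have upper: "hausdorff_dim ?W \<le> ereal s" if "0 < s" "hausdorff_measure s ?W = 0" for s
      unfolding hausdorff_dim_def using that by (intro Inf_lower) force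
    have "hausdorff_dim ?W \<le> 4 / ?l"
    proof (rule dense_ge)
      fix y assume y: "4 / ?l < y"
      then obtain s where s: "4 / ?l < ereal s" "ereal s < y" using ereal_dense2 by blast
      have "0 \<le> 4 / ?l" using l0 by (cases ?l) (auto simp: divide_ereal_def)
      then have "0 < ereal s" using s(1) by (rule order_le_less_trans)
      then have "0 < s" by simp
      then have "ereal (4 / s) < ?l" using s(1) ereal_less_divide_iff(2)[OF l0] by blast
      then obtain b where b: "ereal (4 / s) < ereal b" "ereal b < ?l" using ereal_dense2 by blast
      then have "4 / s < b" by simp
      moreover have "0 < 4 / s" using \<open>0 < s\<close> by simp
      ultimately have "0 < b" by linarith
      have "4 < b * s" using \<open>4 / s < b\<close> \<open>0 < s\<close> by (simp add: field_simps)
      obtain X where X: "\<forall>x\<ge>X. \<psi> x \<le> x powr - b"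
        using less_lower_order_imp_eventually[OF pos b(2)] ..
      have "hausdorff_measure s ?W = 0"
        by (rule hausdorff_measure_approximable_eq_0[OF mono \<open>0 < b\<close> \<open>4 < b * s\<close> \<open>0 < s\<close> X[rule_format]])
      then have "hausdorff_dim ?W \<le> ereal s" by (rule upper[OF \<open>0 < s\<close>])
      then show "hausdorff_dim ?W \<le> y" using s(2) by order
    qed
    moreover have "hausdorff_dim ?W \<le> 2"
    proof (rule dense_ge)
      fix y :: ereal assume "2 < y"
      then obtain s where s: "2 < ereal s" "ereal s < y" using ereal_dense2 by blast
      then have "2 < s" by (metis less_ereal.simps(1) numeral_eq_ereal)
      then have "hausdorff_measure s ?W = 0"
        by (rule hausdorff_measure_unit_square_eq_0[OF _ approximable_set_subset_unit_square])
      then have "hausdorff_dim ?W \<le> ereal s" using upper[of s] \<open>2 < s\<close> by simp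
      then show "hausdorff_dim ?W \<le> y" using s(2) by order
    qed
    ultimately show "hausdorff_dim ?W \<le> min (4 / ?l) 2" by simp
    show "min (4 / ?l) 2 \<le> hausdorff_dim ?W"
      unfolding hausdorff_dim_def
    proof (rule Inf_greatest, rule ccontr)
      fix y assume "y \<in> {ereal s |s. 0 \<le> s \<and> hausdorff_measure s ?W = 0}" and neg: "\<not> min (4 / ?l) 2 \<le> y"
      then obtain u where u: "0 \<le> u" "hausdorff_measure u ?W = 0" "y = ereal u" by blast
      with neg have "ereal u < min (4 / ?l) 2" by (simp add: not_le)
      \<comment> \<open>An intermediate exponent is positive even when \<open>u = 0\<close>, and it
        leaves room for \<open>b\<close> between \<open>max ?l 2\<close> and
        \<open>4 / s\<close>.\<close>
      then obtain s where s: "ereal u < ereal s" "ereal s < min (4 / ?l) 2" using ereal_dense2 by blast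
      then have "0 < s" "u \<le> s" using u(1) by auto
      have "ereal s < 4 / ?l" "ereal s < 2" using s(2) by auto
      then have "s < 2" by (metis less_ereal.simps(1) numeral_eq_ereal)
      then have "2 < 4 / s" using \<open>0 < s\<close> by (simp add: field_simps)
      moreover have "?l < ereal (4 / s)"
        using \<open>ereal s < 4 / ?l\<close> ereal_less_divide_iff(1)[OF l0 \<open>0 < s\<close>] by blast
      ultimately have "max ?l (ereal 2) < ereal (4 / s)" by simp
      then obtain b where "max ?l (ereal 2) < ereal b" "ereal b < ereal (4 / s)" using ereal_dense2 by blast
      then have b: "?l < ereal b" "2 < b" "b * s < 4" using \<open>0 < s\<close> by (auto simp: field_simps)
      have "hausdorff_measure u ?W \<noteq> 0"
        by (rule hausdorff_measure_approximable_neq_0[OF pos mono \<open>0 < s\<close> _ b(2,3) lower_order_less_imp_frequently[OF pos b(1)] u(1) \<open>u \<le> s\<close>])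
          (use \<open>s < 2\<close> in auto)
      with u(2) show False by contradiction
    qed
  qed
  show "packing_dim ?W = 2"
  proof (rule antisym)
    show "packing_dim ?W \<le> 2"
    proof (rule dense_ge)
      fix y :: ereal assume "2 < y"
      then obtain s where s: "2 < ereal s" "ereal s < y" using ereal_dense2 by blast
      then have "2 < s" by (metis less_ereal.simps(1) numeral_eq_ereal)
      then have "packing_measure s ?W = 0"
        by (rule packing_measure_unit_square_eq_0[OF _ approximable_set_subset_unit_square])
      then have "packing_dim ?W \<le> ereal s"
        unfolding packing_dim_def using \<open>2 < s\<close> by (intro Inf_lower) force
      then show "packing_dim ?W \<le> y" using s(2) by order
    qed
    show "2 \<le> packing_dim ?W"
      unfolding packing_dim_def
    proof (rule Inf_greatest, rule ccontr)
      fix y assume "y \<in> {ereal s |s. 0 \<le> s \<and> packing_measure s ?W = 0}" and neg: "\<not> 2 \<le> y"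
      then obtain s where s: "0 \<le> s" "packing_measure s ?W = 0" "y = ereal s" by blast
      with neg have "s < 2" by (metis less_ereal.simps(1) not_le numeral_eq_ereal)
      have "packing_measure s ?W \<noteq> 0"
        by (rule packing_measure_approximable_neq_0[OF pos s(1) \<open>s < 2\<close>])
      with s(2) show False by contradiction
    qed
  qed
qed

end
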